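(* Let $p$ be a prime number and let $\eta,r\in\mathbb{N}$, $\eta,r\ge1$, be such that $\eta<r$ if $p$ is odd, and $(\eta,r)=(1,2)$ if $p=2$. Let $H:=\mathbb{Z}_{p^\eta}$, with the trivial linear cycle set structure, and let $I:=\mathbb{Z}_{p^r}$. Let $a,b\in\mathbb{Z}_{p^r}$ satisfy $a^{p^\eta}=1$, $p^\eta b=0$ and $b^2=0$, and let $\beta,k',u,q,q',k''$ be attached to $(a,b)$ as in the context. Say that a set $P\subseteq\mathbb{Z}_{p^r}\oplus\mathbb{Z}_{p^r}$ is a complete parameter set if for each $(\gamma,\mathfrak{f}_0)\in P$ the pair $(\alpha_\gamma,f_{\mathfrak{f}_0})$ is a $2$-cocycle and every $2$-cocycle is cohomologous to $(\alpha_\gamma,f_{\mathfrak{f}_0})$ for exactly one $(\gamma,\mathfrak{f}_0)\in P$. Then the following three cases arise. (I) $p=2$. Then $(b,a)\in\{(0,1),(0,3),(2,1),(2,3)\}$, and a complete parameter set is: - $\{(0,0),(0,2),(1,0),(1,2)\}$ if $(b,a)=(0,1)$; - $\{(0,0),(2,0),(1,1),(3,1)\}$ if $(b,a)=(0,3)$; - $\{(0,0),(2,0)\}$ if $(b,a)=(2,1)$; - $\{(0,0),(2,2),(1,1),(3,3)\}$ if $(b,a)=(2,3)$. (II) $p$ odd and $\eta\le q$. - If $q'\le\beta$, a complete parameter set is $\{(p^{r-q'}z_1,\,p^{r-\eta}z_2):0\le z_1<p^{\eta-r+q'},\ 0\le z_2<p^\eta\}$. - If $q'>\beta$, then $a\ne1$,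 $q=\beta$, and a complete parameter set is $\{(p^{r-q'}z_1,\,p^{r-q'+\beta-\eta}(k''-k')z_1+p^{r-\eta}z_2):0\le z_1<p^{\eta-r+q'},\ 0\le z_2<p^\eta\}$. (III) $p$ odd and $q<\eta$. This case is divided into the following five subcases. - If $q=q'=\beta$, a complete parameter set is $\{(p^{r-q'}z_1,\,p^{r-\eta}z_2):0\le z_1<p^{q'},\ 0\le z_2<p^{\beta+\eta-r}\}$. - If $q=q'<\beta$, then $a\neq1$, $r-q=\eta-u$, and a complete parameter set is $\{(p^{r-q'}z_1,\,p^{r-\eta}z_2):0\le z_1<p^{q'},\ 0\le z_2<p^{u}\}$. - If $q'=\beta<q$, then $a\ne1$, $r-q'=\eta-u$, and a complete parameter set is $\{(p^{r-q'}z_1,\,p^{r-\eta}z_2):0\le z_1<p^{q'},\ 0\le z_2<p^{q-r+\eta}\}$. - If $q=\beta<q'$ and $q'\le r-\eta+\beta$, then $a\neq1$, $r-q=\eta-u$, and a complete parameter set is $\{(p^{r-q'}z_1,\,p^{r+\beta-q'-\eta}k'z_1+p^{r-\eta}z_2):0\le z_1<p^{\eta-r+q'},\ 0\le z_2<p^{q}\}$. - If $q=\beta<q'$ and $q'>r-\eta+\beta$, then $a\neq1$, $r-q=\eta-u$, and a complete parameter set is $\{(p^{\eta-\beta}z_1,\,k'z_1+p^{r-\eta}z_2):0\le z_1,z_2<p^{\beta}\}$. (All sets are subsets of $\mathbb{Z}_{p^r}\oplus\mathbb{Z}_{p^r}$.)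
   Context: $\mathbb{Z}_n$ denotes the ring of integers modulo $n$. An expression such as $0\le z<p^m$ for $z\in\mathbb{Z}_{p^r}$ means that $z$ is the class of an integer (also denoted $z$) in that range. Elements of $H=\mathbb{Z}_{p^\eta}$ are always represented by integers $0\le h<p^\eta$. A linear cycle set is an additive abelian group $L$ with a binary operation $\cdot$ such that all maps $m\mapsto l\cdot m$ are bijective, $l\cdot(m+n)=l\cdot m+l\cdot n$ and $(l+m)\cdot n=(l\cdot m)\cdot(l\cdot n)$ for all $l,m,n\in L$. It is trivial if $l\cdot m=m$ for all $l,m$. The groups $H$ and $I$ are considered as trivial linear cycle sets. Actions. Elements $a,b\in\mathbb{Z}_{p^r}$ with $a^{p^\eta}=1$, $p^\eta b=0$, $b^2=0$ correspond to the admissible pairs of actions $H\times I\to I$, $h\diamond y=a^hy$, and $I\times H\to I$, $y\prec h=b\,h\,y$. Cocycles. For maps $g,f\colon H\times H\to I$ let $I\times_{g,f}H$ be the set $I\times H$ with operations $(y,h)+(z,l)=(y+z+g(h,l),\,h+l)$ and $(y,h)\cdot(z,l)=(a^hz+f(h,l)+b\,a^h\,y\,l,\;l)$. The pair $(g,f)$ is called a $2$-cocycle if $I\times_{g,f}H$ is a linear cycle set and $I\to I\times_{g,f}H\to H$, $y\mapsto(y,0)$, $(y,h)\mapsto h$, is an extension of linear cycle sets (a short exact sequence of additive abelian groups whose maps are linear cycle set morphisms). Two $2$-cocycles $(g,f)$, $(g',f')$ are cohomologous (equal modulo coboundaries) if there is a map $\varphi\colon H\to I$ with $\varphi(0)=0$,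 $\varphi(h)-\varphi(h+l)+\varphi(l)=g(h,l)-g'(h,l)$ and $\varphi(l)+f(h,l)=a^h\varphi(l)+f'(h,l)+b\,l\,a^h\varphi(h)$ for all $h,l\in H$; equivalently, if the corresponding extensions are equivalent. For $\gamma,\mathfrak{f}_0\in\mathbb{Z}_{p^r}$ and integers $0\le h,h'<p^\eta$, put $\alpha_\gamma(h,h')=\gamma$ if $h+h'\ge p^\eta$ and $\alpha_\gamma(h,h')=0$ if $h+h'<p^\eta$, and $$f_{\mathfrak{f}_0}(h,h')=\sum_{j=0}^{h-1}h'a^{h-j-1}\mathfrak{f}_0+\sum_{j=1}^{h-1}j\,h'\,b\,a^j\,\mathfrak{f}_0 .$$ Data attached to $(a,b)$. If $b\neq0$, write $b=p^\beta k'$ with $0\le\beta<r$, $k'\in\mathbb{Z}_{p^r}$, $p\nmid k'$; if $b=0$, set $\beta:=r$ and $k':=1$. One has $a=1+p^{r-\eta}k$ for some $k$; if $a\neq1$, write $a-1=p^{r-\eta+u}s$ with $0\le u<\eta$ and $p\nmid s$; if $a=1$, set $u:=\eta$. The integers $q,q'\le r$ are the largest ones such that $p^q\mid ba+a-1$ and $p^{q'}\mid ba-a+1$ in $\mathbb{Z}_{p^r}$, and $k''\in\mathbb{Z}_{p^r}^{\times}$ is such that $ba+a-1=p^qk''$ (if $a=1$, one takes $k''=k'$). *)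

theory Defs
  imports "HOL-Algebra.Elementary_Groups" "HOL-Number_Theory.Cong"
begin

text \<open>
  The ring of integers modulo \<open>n\<close> is represented throughout by the integers \<open>0 \<le> x < n\<close>, with
  arithmetic modulo \<open>n\<close>; its additive group is \<^const>\<open>integer_mod_group\<close>. Additive groups
  are \<open>HOL-Algebra\<close> groups, so that \<open>\<otimes>\<close> is the addition of a linear cycle set and \<open>\<one>\<close> its zero.
\<close>

record 'a lcs = "'a monoid" +
  dot :: "'a \<Rightarrow> 'a \<Rightarrow> 'a" (infixl \<open>\<bullet>\<index>\<close> 70)

locale linear_cycle_set = comm_group L for L :: "('a, 'm) lcs_scheme" (structure) +
  assumes dot_bij: "l \<in> carrier L \<Longrightarrow> bij_betw (\<lambda>m. l \<bullet> m) (carrier L) (carrier L)"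
    and dot_add: "\<lbrakk>l \<in> carrier L; m \<in> carrier L; n \<in> carrier L\<rbrakk>
      \<Longrightarrow> l \<bullet> (m \<otimes> n) = (l \<bullet> m) \<otimes> (l \<bullet> n)"
    and add_dot: "\<lbrakk>l \<in> carrier L; m \<in> carrier L; n \<in> carrier L\<rbrakk>
      \<Longrightarrow> (l \<otimes> m) \<bullet> n = (l \<bullet> m) \<bullet> (l \<bullet> n)"

definition trivial_lcs :: "'a monoid \<Rightarrow> 'a lcs" where
  "trivial_lcs G =
    \<lparr>carrier = carrier G, monoid.mult = monoid.mult G, one = one G, dot = (\<lambda>l m. m)\<rparr>"

definition lcs_hom :: "'a lcs \<Rightarrow> 'b lcs \<Rightarrow> ('a \<Rightarrow> 'b) set" where
  "lcs_hom L M = {\<phi> \<in> hom L M.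
    \<forall>x\<in>carrier L. \<forall>y\<in>carrier L. \<phi> (x \<bullet>\<^bsub>L\<^esub> y) = \<phi> x \<bullet>\<^bsub>M\<^esub> \<phi> y}"

definition lcs_extension ::
  "'a lcs \<Rightarrow> 'b lcs \<Rightarrow> 'c lcs \<Rightarrow> ('a \<Rightarrow> 'b) \<Rightarrow> ('b \<Rightarrow> 'c) \<Rightarrow> bool" where
  "lcs_extension I B H \<iota> \<pi> \<longleftrightarrow>
     linear_cycle_set I \<and> linear_cycle_set B \<and> linear_cycle_set H \<and>
     \<iota> \<in> lcs_hom I B \<and> \<pi> \<in> lcs_hom B H \<and>
     inj_on \<iota> (carrier I) \<and> \<iota> ` carrier I = kernel B H \<pi> \<and> \<pi> ` carrier B = carrier H"

definition H_lcs :: "nat \<Rightarrow> nat \<Rightarrow> int lcs" where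
  "H_lcs p \<eta> = trivial_lcs (integer_mod_group (p ^ \<eta>))"

definition I_lcs :: "nat \<Rightarrow> nat \<Rightarrow> int lcs" where
  "I_lcs p r = trivial_lcs (integer_mod_group (p ^ r))"

text \<open>
  The field \<open>one\<close> is the only possible neutral element of the addition; it is \<open>(0, 0)\<close> as soon
  as \<open>y \<mapsto> (y, 0)\<close> is additive.
\<close>

definition ext_lcs ::
  "nat \<Rightarrow> nat \<Rightarrow> nat \<Rightarrow> int \<Rightarrow> int \<Rightarrow> (int \<Rightarrow> int \<Rightarrow> int) \<Rightarrow> (int \<Rightarrow> int \<Rightarrow> int) \<Rightarrow> (int \<times> int) lcs"
  where
  "ext_lcs p \<eta> r a b g f =
    \<lparr>carrier = carrier (I_lcs p r) \<times> carrier (H_lcs p \<eta>),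
     monoid.mult = (\<lambda>(y, h) (z, l). ((y + z + g h l) mod int (p ^ r), (h + l) mod int (p ^ \<eta>))),
     one = ((- g 0 0) mod int (p ^ r), 0),
     dot = (\<lambda>(y, h) (z, l). ((a ^ nat h * z + f h l + b * a ^ nat h * y * l) mod int (p ^ r), l))\<rparr>"

definition two_cocycle ::
  "nat \<Rightarrow> nat \<Rightarrow> nat \<Rightarrow> int \<Rightarrow> int \<Rightarrow> (int \<Rightarrow> int \<Rightarrow> int) \<Rightarrow> (int \<Rightarrow> int \<Rightarrow> int) \<Rightarrow> bool" where
  "two_cocycle p \<eta> r a b g f \<longleftrightarrow>
     g \<in> carrier (H_lcs p \<eta>) \<rightarrow> carrier (H_lcs p \<eta>) \<rightarrow> carrier (I_lcs p r) \<and>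
     f \<in> carrier (H_lcs p \<eta>) \<rightarrow> carrier (H_lcs p \<eta>) \<rightarrow> carrier (I_lcs p r) \<and>
     lcs_extension (I_lcs p r) (ext_lcs p \<eta> r a b g f) (H_lcs p \<eta>) (\<lambda>y. (y, 0)) snd"

definition cohomologous ::
  "nat \<Rightarrow> nat \<Rightarrow> nat \<Rightarrow> int \<Rightarrow> int \<Rightarrow> (int \<Rightarrow> int \<Rightarrow> int) \<Rightarrow> (int \<Rightarrow> int \<Rightarrow> int)
    \<Rightarrow> (int \<Rightarrow> int \<Rightarrow> int) \<Rightarrow> (int \<Rightarrow> int \<Rightarrow> int) \<Rightarrow> bool" where
  "cohomologous p \<eta> r a b g f g' f' \<longleftrightarrow>
     (\<exists>\<phi> \<in> carrier (H_lcs p \<eta>) \<rightarrow> carrier (I_lcs p r). \<phi> 0 = 0 \<and>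
        (\<forall>h\<in>carrier (H_lcs p \<eta>). \<forall>l\<in>carrier (H_lcs p \<eta>).
           [\<phi> h - \<phi> ((h + l) mod int (p ^ \<eta>)) + \<phi> l = g h l - g' h l] (mod int (p ^ r)) \<and>
           [\<phi> l + f h l = a ^ nat h * \<phi> l + f' h l + b * l * a ^ nat h * \<phi> h] (mod int (p ^ r))))"

definition alpha_cocycle :: "nat \<Rightarrow> nat \<Rightarrow> int \<Rightarrow> int \<Rightarrow> int \<Rightarrow> int" where
  "alpha_cocycle p \<eta> \<gamma> h h' = (if h + h' \<ge> int (p ^ \<eta>) then \<gamma> else 0)"

definition f_cocycle :: "nat \<Rightarrow> nat \<Rightarrow> int \<Rightarrow> int \<Rightarrow> int \<Rightarrow> int \<Rightarrow> int \<Rightarrow> int" where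
  "f_cocycle p r a b f\<^sub>0 h h' =
     ((\<Sum>j\<in>{0..<nat h}. h' * a ^ (nat h - j - 1) * f\<^sub>0) +
      (\<Sum>j\<in>{1..<nat h}. int j * h' * b * a ^ j * f\<^sub>0)) mod int (p ^ r)"

definition complete_parameter_set ::
  "nat \<Rightarrow> nat \<Rightarrow> nat \<Rightarrow> int \<Rightarrow> int \<Rightarrow> (int \<times> int) set \<Rightarrow> bool" where
  "complete_parameter_set p \<eta> r a b P \<longleftrightarrow>
     P \<subseteq> carrier (I_lcs p r) \<times> carrier (I_lcs p r) \<and>
     (\<forall>(\<gamma>, f\<^sub>0)\<in>P. two_cocycle p \<eta> r a b (alpha_cocycle p \<eta> \<gamma>) (f_cocycle p r a b f\<^sub>0)) \<and>
     (\<forall>g f. two_cocycle p \<eta> r a b g f \<longrightarrow>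
        (\<exists>!x. x \<in> P \<and> (case x of (\<gamma>, f\<^sub>0) \<Rightarrow>
           cohomologous p \<eta> r a b g f (alpha_cocycle p \<eta> \<gamma>) (f_cocycle p r a b f\<^sub>0))))"

definition admissible_pair :: "nat \<Rightarrow> nat \<Rightarrow> nat \<Rightarrow> int \<Rightarrow> int \<Rightarrow> bool" where
  "admissible_pair p \<eta> r a b \<longleftrightarrow>
     a \<in> carrier (I_lcs p r) \<and> b \<in> carrier (I_lcs p r) \<and>
     [a ^ (p ^ \<eta>) = 1] (mod int (p ^ r)) \<and>
     [int (p ^ \<eta>) * b = 0] (mod int (p ^ r)) \<and>
     [b\<^sup>2 = 0] (mod int (p ^ r))"

text \<open>
  The classes \<open>k'\<close> and \<open>k''\<close> are not determined by \<open>(a, b)\<close>, so they are related to it by a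
  predicate. Divisibility by \<open>p\<^sup>i\<close> in \<open>\<int>/p\<^sup>r\<close> is divisibility of a representative, since \<open>i \<le> r\<close>.
\<close>

definition attached_data ::
  "nat \<Rightarrow> nat \<Rightarrow> nat \<Rightarrow> int \<Rightarrow> int \<Rightarrow> nat \<Rightarrow> int \<Rightarrow> nat \<Rightarrow> nat \<Rightarrow> nat \<Rightarrow> int \<Rightarrow> bool" where
  "attached_data p \<eta> r a b \<beta> k' u q q' k'' \<longleftrightarrow>
     (if b \<noteq> 0
      then \<beta> < r \<and> k' \<in> carrier (I_lcs p r) \<and> \<not> int p dvd k' \<and>
           [b = int p ^ \<beta> * k'] (mod int (p ^ r))
      else \<beta> = r \<and> k' = 1) \<and>
     (if a \<noteq> 1
      then u < \<eta> \<and> (\<exists>s\<in>carrier (I_lcs p r). \<not> int p dvd s \<and>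
           [a - 1 = int p ^ (r - \<eta> + u) * s] (mod int (p ^ r)))
      else u = \<eta>) \<and>
     q = Max {i. i \<le> r \<and> int p ^ i dvd b * a + a - 1} \<and>
     q' = Max {i. i \<le> r \<and> int p ^ i dvd b * a - a + 1} \<and>
     k'' \<in> carrier (I_lcs p r) \<and> coprime k'' (int p) \<and>
     [b * a + a - 1 = int p ^ q * k''] (mod int (p ^ r)) \<and>
     (a = 1 \<longrightarrow> k'' = k')"

definition param_set :: "nat \<Rightarrow> nat \<Rightarrow> int \<Rightarrow> int \<Rightarrow> int \<Rightarrow> nat \<Rightarrow> nat \<Rightarrow> (int \<times> int) set" where
  "param_set p r c\<^sub>1 c\<^sub>2 c\<^sub>3 n\<^sub>1 n\<^sub>2 =
     {((c\<^sub>1 * z\<^sub>1) mod int (p ^ r), (c\<^sub>2 * z\<^sub>1 + c\<^sub>3 * z\<^sub>2) mod int (p ^ r)) | z\<^sub>1 z\<^sub>2.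
        0 \<le> z\<^sub>1 \<and> z\<^sub>1 < int n\<^sub>1 \<and> 0 \<le> z\<^sub>2 \<and> z\<^sub>2 < int n\<^sub>2}"

end

theory Submission
  imports Defs
begin

text \<open>
  Write \<open>N = p\<^sup>\<eta>\<close>, \<open>M = p\<^sup>r\<close>, \<open>c = a (1 + b)\<close> and \<open>[n]\<^sub>c = 1 + c + \<dots> + c\<^sup>n\<^sup>-\<^sup>1\<close>. Since \<open>H\<close> is cyclic, every
  cocycle is cohomologous to one with \<open>g = \<alpha>\<^sub>\<gamma>\<close>; the distributivity law then makes \<open>f(h, l)\<close> linear
  in \<open>l\<close>, and the other law is a recursion in \<open>h\<close> with solution \<open>f(h, l) = l [h]\<^sub>c f\<^sub>0\<close>. What remains
  are the linear conditions \<open>N f\<^sub>0 = (a - 1) \<gamma>\<close> and \<open>[N]\<^sub>c f\<^sub>0 = b \<gamma>\<close> modulo \<open>M\<close>. A coboundary between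
  two such cocycles is given by \<open>\<phi>(h) = h t\<close>, so the cohomology group is the group of solutions
  \<open>(\<gamma>, f\<^sub>0)\<close> modulo the multiples of \<open>(N, c - 1)\<close>. For odd \<open>p\<close> one has \<open>[N]\<^sub>c = N\<close> modulo \<open>M\<close>, and
  representatives are found by reducing one of the two components along \<open>(N, c - 1)\<close> and then the
  other one; which order to use depends on the valuations of \<open>a - 1\<close>, \<open>b a\<close> and \<open>b a \<plusminus> (a - 1)\<close>, where
  the minimum of any three of them is attained twice.
\<close>

section \<open>Congruences and geometric sums\<close>

lemma linear_cycle_set_trivial_lcs:
  assumes "comm_group G"
  shows "linear_cycle_set (trivial_lcs G)"
proof -
  interpret comm_group G by fact
  have "comm_group (trivial_lcs G)"
    by (rule comm_groupI) (auto simp: trivial_lcs_def m_assoc intro: l_inv_ex m_comm)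
  then show ?thesis
    by (auto simp: linear_cycle_set_def linear_cycle_set_axioms_def trivial_lcs_def bij_betw_def)
qed

text \<open>The polynomial content of l . (m + n) = l . m + l . n in the extension: A stands for a
  power of a, and u, v, w for first components reduced modulo M. The reduced sum s occurs only
  multiplied by b, so a congruence for \<open>b * s\<close> suffices although s is reduced modulo
  N.\<close>

lemma dvd_dot_add:
  fixes M :: "'a :: idom"
  assumes "M dvd f\<^sub>1 + f\<^sub>2 - f\<^sub>3 - (A - 1) * g" and "M dvd b * s - b * (l + l')"
    and "M dvd u - (z + z' + g)"
    and "M dvd v - (A * z + f\<^sub>1 + b * A * y * l)" and "M dvd w - (A * z' + f\<^sub>2 + b * A * y * l')"
  shows "M dvd (A * u + f\<^sub>3 + b * A * y * s) - (v + w + g)"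
  using assms by algebra

text \<open>The same for (l + m) . n = (l . m) . (l . n), with C for the power of a at the reduced
  sum of the second components. Substituting w produces a term quadratic in b, which
  vanishes.\<close>

lemma dvd_add_dot:
  fixes M :: "'a :: idom"
  assumes "M dvd f\<^sub>1 + b * A * A' * g * l - A' * f\<^sub>2 - f\<^sub>3 - b * A' * f\<^sub>4 * l"
    and "M dvd C - A * A'" and "M dvd b * b"
    and "M dvd u - (y + y' + g)"
    and "M dvd v - (A * z + f\<^sub>2 + b * A * y * l)" and "M dvd w - (A * y' + f\<^sub>4 + b * A * y * h')"
  shows "M dvd (C * z + f\<^sub>1 + b * C * u * l) - (A' * v + f\<^sub>3 + b * A' * w * l)"
  using assms by algebra

lemma dvd_add_dot_zero:
  fixes M :: "'a :: idom"
  assumes "M dvd (f\<^sub>1 + b * C * g * m) - (A' * f\<^sub>2 + f\<^sub>3 + b * A' * f\<^sub>4 * m)" and "M dvd C - A * A'"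
  shows "M dvd f\<^sub>1 + b * A * A' * g * m - A' * f\<^sub>2 - f\<^sub>3 - b * A' * f\<^sub>4 * m"
  using assms by algebra

lemma dvd_imp_eq_0: "x = 0" if "M dvd x" "x \<in> {0..<M}" for x M :: int
  using that by (metis atLeastLessThan_iff dvd_imp_mod_0 mod_pos_pos_trivial)

lemma dvd_mod_minus: "m dvd x mod m - x" for x m :: int
  by (simp flip: mod_eq_dvd_iff)

lemma mod_inner:
  fixes x y z m :: int
  shows "(x + (y mod m + z)) mod m = (x + (y + z)) mod m"
    and "(x * (y mod m) + z) mod m = (x * y + z) mod m"
  by (metis mod_add_left_eq mod_add_right_eq mod_mult_right_eq)+

text \<open>Stability of the equation under a coboundary: x, \<open>x\<^sub>1\<close>,
  \<open>x\<^sub>2\<close>, \<open>x\<^sub>3\<close> are the values of a cochain \<phi> at m, h, l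
  and the reduced sum of h and l. They cancel because C = A A' and b^2 = 0.\<close>

lemma dvd_coboundary_dot:
  fixes M :: "'a :: idom"
  assumes "M dvd f\<^sub>1 + b * A * A' * g * m - A' * f\<^sub>2 - f\<^sub>3 - b * A' * f\<^sub>4 * m"
    and "M dvd C - A * A'" and "M dvd b * b"
  shows "M dvd (f\<^sub>1 + x - C * x - b * m * C * x\<^sub>3) + b * A * A' * (g - x\<^sub>1 - x\<^sub>2 + x\<^sub>3) * m
    - A' * (f\<^sub>2 + x - A * x - b * m * A * x\<^sub>1) - (f\<^sub>3 + x - A' * x - b * m * A' * x\<^sub>2)
    - b * A' * (f\<^sub>4 + x\<^sub>2 - A * x\<^sub>2 - b * l * A * x\<^sub>1) * m"
  using assms by algebra

lemma dvd_coboundary_add: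
  fixes M :: "'a :: idom"
  assumes "M dvd f\<^sub>1 + f\<^sub>2 - f\<^sub>3 - (A - 1) * g" and "M dvd b * s - b * (l + m)"
  shows "M dvd (f\<^sub>1 + x\<^sub>1 - A * x\<^sub>1 - b * l * A * x) + (f\<^sub>2 + x\<^sub>2 - A * x\<^sub>2 - b * m * A * x)
    - (f\<^sub>3 + x\<^sub>3 - A * x\<^sub>3 - b * s * A * x) - (A - 1) * (g - x\<^sub>1 - x\<^sub>2 + x\<^sub>3)"
  using assms by algebra

section \<open>Geometric sums\<close>

definition geo :: "'a :: comm_ring_1 \<Rightarrow> nat \<Rightarrow> 'a" where
  "geo x n = (\<Sum>j<n. x ^ j)"

lemma geo_0 [simp]: "geo x 0 = 0" and geo_1 [simp]: "geo x (Suc 0) = 1"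
  and geo_Suc: "geo x (Suc n) = geo x n + x ^ n"
  by (simp_all add: geo_def)

lemma geo_Suc_shift: "geo x (Suc n) = x * geo x n + 1"
  by (simp only: geo_def sum.lessThan_Suc_shift power_Suc power_0 sum_distrib_left add.commute)

lemma geo_add: "geo x (m + n) = x ^ n * geo x m + geo x n"
  by (induction m) (simp_all add: geo_Suc algebra_simps power_add)

lemma geo_mult: "geo x (m * n) = geo x m * geo (x ^ m) n"
proof (induction n)
  case (Suc n)
  have "geo x (m * Suc n) = x ^ m * geo x (m * n) + geo x m"
    using geo_add [of x "m * n" m] by (simp add: add.commute)
  then show ?case by (simp add: Suc geo_Suc_shift algebra_simps)
qed simp

lemma power_diff_geo: "x ^ n - 1 = (x - 1) * geo x n"
proof (induction n)
  case (Suc n)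
  show ?case
    by (simp only: geo_Suc distrib_left Suc.IH [symmetric] power_Suc) (simp add: algebra_simps)
qed simp

text \<open>Together with the three lemmas below, the reason why each cocycle equation depends on
  the values of g and f only modulo M.\<close>

lemma dvd_cong_sym:
  fixes M :: "'a :: idom"
  assumes "M dvd g\<^sub>1 - g\<^sub>2" "M dvd g\<^sub>1' - g\<^sub>1" "M dvd g\<^sub>2' - g\<^sub>2"
  shows "M dvd g\<^sub>1' - g\<^sub>2'"
  using assms by algebra

lemma dvd_cong_assoc:
  fixes M :: "'a :: idom"
  assumes "M dvd g\<^sub>1 + g\<^sub>2 - g\<^sub>3 - g\<^sub>4"
    and "M dvd g\<^sub>1' - g\<^sub>1" "M dvd g\<^sub>2' - g\<^sub>2" "M dvd g\<^sub>3' - g\<^sub>3" "M dvd g\<^sub>4' - g\<^sub>4"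
  shows "M dvd g\<^sub>1' + g\<^sub>2' - g\<^sub>3' - g\<^sub>4'"
  using assms by algebra

lemma dvd_cong_add:
  fixes M :: "'a :: idom"
  assumes "M dvd f\<^sub>1 + f\<^sub>2 - f\<^sub>3 - (A - 1) * g"
    and "M dvd f\<^sub>1' - f\<^sub>1" "M dvd f\<^sub>2' - f\<^sub>2" "M dvd f\<^sub>3' - f\<^sub>3" "M dvd g' - g"
  shows "M dvd f\<^sub>1' + f\<^sub>2' - f\<^sub>3' - (A - 1) * g'"
  using assms by algebra

lemma dvd_cong_dot:
  fixes M :: "'a :: idom"
  assumes "M dvd f\<^sub>1 + b * A * A' * g * m - A' * f\<^sub>2 - f\<^sub>3 - b * A' * f\<^sub>4 * m"
    and "M dvd f\<^sub>1' - f\<^sub>1" "M dvd f\<^sub>2' - f\<^sub>2" "M dvd f\<^sub>3' - f\<^sub>3" "M dvd f\<^sub>4' - f\<^sub>4" "M dvd g' - g"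
  shows "M dvd f\<^sub>1' + b * A * A' * g' * m - A' * f\<^sub>2' - f\<^sub>3' - b * A' * f\<^sub>4' * m"
  using assms by algebra

section \<open>Reduction to linear congruences\<close>

locale cyclic_extension =
  fixes p \<eta> r :: nat and a b :: int
  assumes p_gt_1: "p > 1" and eta_pos: "\<eta> \<ge> 1" and r_pos: "r \<ge> 1"
    and admissible: "admissible_pair p \<eta> r a b"
begin

definition "N = int p ^ \<eta>"
definition "M = int p ^ r"
definition "c = a * (1 + b)"

lemma N_fold [simp]: "int p ^ \<eta> = N" and M_fold [simp]: "int p ^ r = M"
  by (simp_all add: N_def M_def)

lemma N_gt_1: "N > 1" and M_gt_1: "M > 1"
  using p_gt_1 eta_pos r_pos by (auto simp: N_def M_def simp del: N_fold M_fold)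

lemma carrier_H [simp]: "carrier (H_lcs p \<eta>) = {0..<N}"
  and carrier_I [simp]: "carrier (I_lcs p r) = {0..<M}"
  using p_gt_1 by (auto simp: H_lcs_def I_lcs_def trivial_lcs_def carrier_integer_mod_group)

lemma ops_H [simp]: "monoid.mult (H_lcs p \<eta>) x y = (x + y) mod N" "one (H_lcs p \<eta>) = 0"
    "dot (H_lcs p \<eta>) x y = y"
  and ops_I [simp]: "monoid.mult (I_lcs p r) x y = (x + y) mod M" "one (I_lcs p r) = 0"
    "dot (I_lcs p r) x y = y"
  by (auto simp: H_lcs_def I_lcs_def trivial_lcs_def)

lemma nat_N: "nat N = p ^ \<eta>"
  by (simp add: N_def nat_power_eq del: N_fold)

lemma a_pow_N: "M dvd a ^ nat N - 1" and N_b: "M dvd N * b" and b_sq: "M dvd b * b"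
  using admissible by (auto simp: admissible_pair_def cong_iff_dvd_diff nat_N power2_eq_square)

lemma a_range: "0 \<le> a" "a < M" "0 \<le> b" "b < M"
  using admissible by (auto simp: admissible_pair_def)

lemma b_mod_N: "M dvd b * (x mod N) - b * x"
proof -
  have "b * (x mod N) - b * x = - ((x div N) * (N * b))"
    by (simp add: minus_mult_div_eq_mod [symmetric] algebra_simps)
  then show ?thesis using N_b by (metis dvd_minus_iff dvd_mult)
qed

text \<open>If the sum wraps around, the exponents differ by N, and a^N = 1.\<close>

lemma a_pow_mod_N:
  assumes "h \<in> {0..<N}" "l \<in> {0..<N}"
  shows "M dvd a ^ nat ((h + l) mod N) - a ^ nat h * a ^ nat l"
proof (cases "h + l < N")
  case True
  then show ?thesis using assms by (simp add: nat_add_distrib power_add)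
next
  case False
  then have "(h + l) mod N = h + l - N"
    using assms mod_pos_pos_trivial [of "h + l - N" N] by simp
  then have "nat h + nat l = nat ((h + l) mod N) + nat N"
    using False assms N_gt_1 by auto
  then have "a ^ nat h * a ^ nat l = a ^ nat ((h + l) mod N) * a ^ nat N"
    by (metis power_add)
  moreover have "M dvd x - x * y" if "M dvd y - 1" for x y
    using that by algebra
  ultimately show ?thesis using a_pow_N by simp
qed

lemma a_coprime: "coprime a M"
proof -
  have "coprime (a ^ nat N) M"
    using a_pow_N by (metis cong_iff_dvd_diff cong_imp_coprime cong_sym coprime_1_left)
  then show ?thesis
    using N_gt_1 by (simp add: coprime_power_left_iff)
qed

text \<open>The axioms of the extension read off at elements with first component zero: symmetry and
  associativity of the addition, then the two laws of the operation. The values at (0, 0) come from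
  y -> (y, 0) being a morphism. The last equation uses a product of powers of a instead of the power
  at the reduced sum, which keeps it polynomial.\<close>

definition cocycle_eqs :: "(int \<Rightarrow> int \<Rightarrow> int) \<Rightarrow> (int \<Rightarrow> int \<Rightarrow> int) \<Rightarrow> bool" where
  "cocycle_eqs g f \<longleftrightarrow> M dvd g 0 0 \<and> M dvd f 0 0 \<and>
    (\<forall>h\<in>{0..<N}. \<forall>l\<in>{0..<N}. M dvd g h l - g l h) \<and>
    (\<forall>h\<in>{0..<N}. \<forall>l\<in>{0..<N}. \<forall>m\<in>{0..<N}.
       M dvd g h l + g ((h + l) mod N) m - g l m - g h ((l + m) mod N) \<and>
       M dvd f h l + f h m - f h ((l + m) mod N) - (a ^ nat h - 1) * g l m \<and>
       M dvd f ((h + l) mod N) m + b * a ^ nat h * a ^ nat l * g h l * m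
         - a ^ nat l * f h m - f l m - b * a ^ nat l * f h l * m)"

lemma cocycle_eqsD:
  assumes "cocycle_eqs g f"
  shows "M dvd g 0 0" "M dvd f 0 0"
    and "\<And>h l. \<lbrakk>h \<in> {0..<N}; l \<in> {0..<N}\<rbrakk> \<Longrightarrow> M dvd g h l - g l h"
    and "\<And>h l m. \<lbrakk>h \<in> {0..<N}; l \<in> {0..<N}; m \<in> {0..<N}\<rbrakk> \<Longrightarrow>
       M dvd g h l + g ((h + l) mod N) m - g l m - g h ((l + m) mod N)"
    and "\<And>h l m. \<lbrakk>h \<in> {0..<N}; l \<in> {0..<N}; m \<in> {0..<N}\<rbrakk> \<Longrightarrow>
       M dvd f h l + f h m - f h ((l + m) mod N) - (a ^ nat h - 1) * g l m"
    and "\<And>h l m. \<lbrakk>h \<in> {0..<N}; l \<in> {0..<N}; m \<in> {0..<N}\<rbrakk> \<Longrightarrow>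
       M dvd f ((h + l) mod N) m + b * a ^ nat h * a ^ nat l * g h l * m
         - a ^ nat l * f h m - f l m - b * a ^ nat l * f h l * m"
proof -
  note A = assms [unfolded cocycle_eqs_def]
  note sym = A [THEN conjunct2, THEN conjunct2, THEN conjunct1, THEN bspec, THEN bspec]
  note eqs = A [THEN conjunct2, THEN conjunct2, THEN conjunct2, THEN bspec, THEN bspec, THEN bspec]
  show "M dvd g 0 0" "M dvd f 0 0" using A by simp_all
  show "M dvd g h l - g l h" if "h \<in> {0..<N}" "l \<in> {0..<N}" for h l
    by (rule sym [OF that])
  fix h l m
  assume hlm: "h \<in> {0..<N}" "l \<in> {0..<N}" "m \<in> {0..<N}"
  note eq = eqs [OF hlm]
  show "M dvd g h l + g ((h + l) mod N) m - g l m - g h ((l + m) mod N)"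
    "M dvd f h l + f h m - f h ((l + m) mod N) - (a ^ nat h - 1) * g l m"
    "M dvd f ((h + l) mod N) m + b * a ^ nat h * a ^ nat l * g h l * m
       - a ^ nat l * f h m - f l m - b * a ^ nat l * f h l * m"
    by (rule eq [THEN conjunct1], rule eq [THEN conjunct2, THEN conjunct1],
      rule eq [THEN conjunct2, THEN conjunct2])
qed

section \<open>The cocycle equations characterise the extensions\<close>

lemma ext_simps [simp]:
  "carrier (ext_lcs p \<eta> r a b g f) = {0..<M} \<times> {0..<N}"
  "monoid.mult (ext_lcs p \<eta> r a b g f) (y, h) (z, l) = ((y + z + g h l) mod M, (h + l) mod N)"
  "one (ext_lcs p \<eta> r a b g f) = ((- g 0 0) mod M, 0)"
  "dot (ext_lcs p \<eta> r a b g f) (y, h) (z, l)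
     = ((a ^ nat h * z + f h l + b * a ^ nat h * y * l) mod M, l)"
  by (simp_all add: ext_lcs_def)

lemma two_cocycleI:
  assumes g: "g \<in> {0..<N} \<rightarrow> {0..<N} \<rightarrow> {0..<M}" and f: "f \<in> {0..<N} \<rightarrow> {0..<N} \<rightarrow> {0..<M}"
    and eqs: "cocycle_eqs g f"
  shows "two_cocycle p \<eta> r a b g f"
proof -
  note E = cocycle_eqsD [OF eqs]
  let ?B = "ext_lcs p \<eta> r a b g f"
  have zero: "0 \<in> {0..<N}" "0 \<in> {0..<M}" using N_gt_1 M_gt_1 by auto
  have g00: "g 0 0 = 0" using E(1) g zero dvd_imp_eq_0 [of M] by blast
  have f00: "f 0 0 = 0" using E(2) f zero dvd_imp_eq_0 [of M] by blast
  \<comment> \<open>Associativity at (0, 0, l) gives g(0, l) = g(0, 0), so (0, 0) is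
    neutral.\<close>
  have g0: "M dvd g 0 l" if "l \<in> {0..<N}" for l
    using E(4) [of 0 0 l] that zero g00 by (simp add: mod_pos_pos_trivial)
  have modN: "x mod N \<in> {0..<N}" for x using N_gt_1 by simp
  have "comm_group ?B"
  proof (rule comm_groupI, goal_cases)
    case (1 x y) then show ?case using N_gt_1 M_gt_1 by auto
  next
    case 2 then show ?case using N_gt_1 M_gt_1 by auto
  next
    case (3 x y z)
    obtain x1 x2 y1 y2 z1 z2 where [simp]: "x = (x1, x2)" "y = (y1, y2)" "z = (z1, z2)"
      by (meson surj_pair)
    have "M dvd g x2 y2 + g ((x2 + y2) mod N) z2 - g y2 z2 - g x2 ((y2 + z2) mod N)"
      using 3 by (intro E(4)) auto
    also have "\<dots> = (x1 + y1 + g x2 y2 + z1 + g ((x2 + y2) mod N) z2)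
        - (x1 + (y1 + z1 + g y2 z2) + g x2 ((y2 + z2) mod N))"
      by simp
    finally have "(x1 + y1 + g x2 y2 + z1 + g ((x2 + y2) mod N) z2) mod M
        = (x1 + (y1 + z1 + g y2 z2) + g x2 ((y2 + z2) mod N)) mod M"
      by (simp only: mod_eq_dvd_iff)
    then show ?case by (simp add: mod_simps mod_inner add.assoc)
  next
    case (4 x y)
    obtain x1 x2 y1 y2 where [simp]: "x = (x1, x2)" "y = (y1, y2)"
      by (meson surj_pair)
    have "M dvd g x2 y2 - g y2 x2"
      using 4 by (intro E(3)) auto
    also have "\<dots> = (x1 + y1 + g x2 y2) - (y1 + x1 + g y2 x2)"
      by simp
    finally show ?case by (simp add: mod_eq_dvd_iff add.commute)
  next
    case (5 x)
    obtain x1 x2 where [simp]: "x = (x1, x2)" by (meson surj_pair)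
    have "(x1 + g 0 x2) mod M = x1 mod M"
      unfolding mod_eq_dvd_iff using g0 [of x2] 5 by auto
    also have "\<dots> = x1" using 5 by simp
    finally show ?case using 5 by (simp add: g00)
  next
    case (6 x)
    obtain x1 x2 where [simp]: "x = (x1, x2)" by (meson surj_pair)
    \<comment> \<open>The first component of the inverse must also cancel the value of g at the pair
      formed by the reduced -x2 and x2.\<close>
    show ?case
      using modN [of "- x2"] M_gt_1
      by (intro bexI [of _ "((- x1 - g ((- x2) mod N) x2) mod M, (- x2) mod N)"])
        (auto simp: g00 mod_simps mod_inner add.assoc)
  qed
  then interpret B: comm_group ?B .
  have "linear_cycle_set ?B"
  proof (unfold_locales, goal_cases)
    case (1 x)
    obtain y h where [simp]: "x = (y, h)" by (meson surj_pair)
    \<comment> \<open>The carrier is finite, so injectivity and closure give bijectivity; the power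
      of a can be cancelled because a is a unit.\<close>
    have "inj_on (\<lambda>m. x \<bullet>\<^bsub>?B\<^esub> m) (carrier ?B)"
    proof (rule inj_onI)
      fix m n assume mn: "m \<in> carrier ?B" "n \<in> carrier ?B" "x \<bullet>\<^bsub>?B\<^esub> m = x \<bullet>\<^bsub>?B\<^esub> n"
      obtain z l z' l' where [simp]: "m = (z, l)" "n = (z', l')" by (meson surj_pair)
      from mn have l: "l = l'" and
        "M dvd (a ^ nat h * z + f h l + b * a ^ nat h * y * l)
           - (a ^ nat h * z' + f h l + b * a ^ nat h * y * l)"
        by (auto simp: mod_eq_dvd_iff)
      then have "M dvd a ^ nat h * (z - z')" by (simp add: algebra_simps)
      moreover have "coprime M (a ^ nat h)"
        using a_coprime by (simp add: coprime_commute coprime_power_right_iff)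
      ultimately have "M dvd z - z'" by (simp add: coprime_dvd_mult_right_iff)
      then have "z mod M = z' mod M" by (simp add: mod_eq_dvd_iff)
      then show "m = n" using mn l by simp
    qed
    moreover have "(\<lambda>m. x \<bullet>\<^bsub>?B\<^esub> m) ` carrier ?B \<subseteq> carrier ?B"
      using M_gt_1 by auto
    ultimately show ?case
      by (simp add: bij_betw_def endo_inj_surj)
  next
    case (2 x m n)
    obtain y h z l z' l' where [simp]: "x = (y, h)" "m = (z, l)" "n = (z', l')" by (meson surj_pair)
    have hl: "h \<in> {0..<N}" "l \<in> {0..<N}" "l' \<in> {0..<N}" using 2 by auto
    show ?case
      using dvd_dot_add [OF E(5) [OF hl] b_mod_N dvd_mod_minus dvd_mod_minus dvd_mod_minus]
      by (simp add: mod_eq_dvd_iff)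
  next
    case (3 x m n)
    obtain y h y' h' z l where [simp]: "x = (y, h)" "m = (y', h')" "n = (z, l)" by (meson surj_pair)
    have hl: "h \<in> {0..<N}" "h' \<in> {0..<N}" "l \<in> {0..<N}" using 3 by auto
    show ?case
      using dvd_add_dot [OF E(6) [OF hl] a_pow_mod_N [OF hl(1,2)] b_sq
          dvd_mod_minus dvd_mod_minus dvd_mod_minus]
      by (simp add: mod_eq_dvd_iff)
  qed
  moreover have "linear_cycle_set (I_lcs p r)" "linear_cycle_set (H_lcs p \<eta>)"
    by (simp_all add: I_lcs_def H_lcs_def linear_cycle_set_trivial_lcs)
  moreover have "(\<lambda>y. (y, 0)) \<in> lcs_hom (I_lcs p r) ?B"
    using N_gt_1 by (auto simp: lcs_hom_def hom_def g00 f00)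
  moreover have "snd \<in> lcs_hom ?B (H_lcs p \<eta>)"
    by (auto simp: lcs_hom_def hom_def)
  moreover have "(\<lambda>y. (y, 0)) ` carrier (I_lcs p r) = kernel ?B (H_lcs p \<eta>) snd"
    using N_gt_1 by (auto simp: kernel_def)
  moreover have "snd ` carrier ?B = carrier (H_lcs p \<eta>)"
    using M_gt_1 by force
  ultimately show ?thesis
    using g f by (simp add: two_cocycle_def lcs_extension_def inj_on_def)
qed

text \<open>Each equation is an axiom evaluated at elements with first component 0; the values at
  (0, 0) come from the inclusion of I, evaluated at 0.\<close>

lemma two_cocycle_eqs:
  assumes "two_cocycle p \<eta> r a b g f"
  shows "cocycle_eqs g f"
proof -
  let ?B = "ext_lcs p \<eta> r a b g f"
  have B: "linear_cycle_set ?B" and \<iota>: "(\<lambda>y. (y, 0)) \<in> lcs_hom (I_lcs p r) ?B"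
    using assms by (simp_all add: two_cocycle_def lcs_extension_def)
  interpret B: linear_cycle_set ?B by (fact B)
  have zero: "0 \<in> {0..<N}" "0 \<in> {0..<M}" using N_gt_1 M_gt_1 by auto
  have types: "g \<in> {0..<N} \<rightarrow> {0..<N} \<rightarrow> {0..<M}" "f \<in> {0..<N} \<rightarrow> {0..<N} \<rightarrow> {0..<M}"
    using assms by (simp_all add: two_cocycle_def)
  have "g h l \<in> {0..<M} \<and> f h l \<in> {0..<M}" if "h \<in> {0..<N}" "l \<in> {0..<N}" for h l
    using types that by blast
  then have red: "g h l mod M = g h l" "f h l mod M = f h l" if "h \<in> {0..<N}" "l \<in> {0..<N}" for h l
    using that by simp_all
  show ?thesis unfolding cocycle_eqs_def
  proof (intro conjI ballI)
    have "\<forall>x\<in>{0..<M}. \<forall>y\<in>{0..<M}. ((x + y) mod M, 0) = (x, 0) \<otimes>\<^bsub>?B\<^esub> (y, 0)"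
      using \<iota> unfolding lcs_hom_def hom_def mem_Collect_eq carrier_I ops_I by blast
    then have "(0 + 0) mod M = (0 + 0 + g 0 0) mod M"
      using zero(2) by fastforce
    then show "M dvd g 0 0" by (simp add: dvd_eq_mod_eq_0)
    have "\<forall>x\<in>{0..<M}. \<forall>y\<in>{0..<M}. (y, 0) = (x, 0) \<bullet>\<^bsub>?B\<^esub> (y, 0)"
      using \<iota> unfolding lcs_hom_def mem_Collect_eq carrier_I ops_I by blast
    then have "0 = (a ^ nat 0 * 0 + f 0 0 + b * a ^ nat 0 * 0 * 0) mod M"
      using zero(2) by fastforce
    then show "M dvd f 0 0" by (simp add: dvd_eq_mod_eq_0)
  next
    fix h l assume hl: "h \<in> {0..<N}" "l \<in> {0..<N}"
    have "(0, h) \<otimes>\<^bsub>?B\<^esub> (0, l) = (0, l) \<otimes>\<^bsub>?B\<^esub> (0, h)"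
      using hl zero by (intro B.m_comm) auto
    then show "M dvd g h l - g l h" by (simp add: mod_eq_dvd_iff)
  next
    fix h l m assume hl: "h \<in> {0..<N}" "l \<in> {0..<N}" "m \<in> {0..<N}"
    have "(0, h) \<otimes>\<^bsub>?B\<^esub> (0, l) \<otimes>\<^bsub>?B\<^esub> (0, m) = (0, h) \<otimes>\<^bsub>?B\<^esub> ((0, l) \<otimes>\<^bsub>?B\<^esub> (0, m))"
      using hl zero by (intro B.m_assoc) auto
    then have "(g h l + g ((h + l) mod N) m) mod M = (g l m + g h ((l + m) mod N)) mod M"
      using hl by (simp add: red)
    then show "M dvd g h l + g ((h + l) mod N) m - g l m - g h ((l + m) mod N)"
      by (simp add: mod_eq_dvd_iff algebra_simps)
    have "(0, h) \<bullet>\<^bsub>?B\<^esub> ((0, l) \<otimes>\<^bsub>?B\<^esub> (0, m))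
        = ((0, h) \<bullet>\<^bsub>?B\<^esub> (0, l)) \<otimes>\<^bsub>?B\<^esub> ((0, h) \<bullet>\<^bsub>?B\<^esub> (0, m))"
      using hl zero by (intro B.dot_add) auto
    then have "(a ^ nat h * g l m + f h ((l + m) mod N)) mod M = (f h l + f h m + g l m) mod M"
      using hl by (simp add: red)
    then show "M dvd f h l + f h m - f h ((l + m) mod N) - (a ^ nat h - 1) * g l m"
      by (auto simp: mod_eq_dvd_iff algebra_simps dvd_diff_commute)
    have "((0, h) \<otimes>\<^bsub>?B\<^esub> (0, l)) \<bullet>\<^bsub>?B\<^esub> (0, m)
        = ((0, h) \<bullet>\<^bsub>?B\<^esub> (0, l)) \<bullet>\<^bsub>?B\<^esub> ((0, h) \<bullet>\<^bsub>?B\<^esub> (0, m))"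
      using hl zero by (intro B.add_dot) auto
    then have "(f ((h + l) mod N) m + b * a ^ nat ((h + l) mod N) * g h l * m) mod M
        = (a ^ nat l * f h m + f l m + b * a ^ nat l * f h l * m) mod M"
      using hl by (simp add: red)
    then show "M dvd f ((h + l) mod N) m + b * a ^ nat h * a ^ nat l * g h l * m
         - a ^ nat l * f h m - f l m - b * a ^ nat l * f h l * m"
      unfolding mod_eq_dvd_iff using a_pow_mod_N [OF hl(1,2)] by (rule dvd_add_dot_zero)
  qed
qed

text \<open>The cocycle equations are linear in (g, f) and hold for coboundaries, so g can be
  normalised by a suitable cochain.\<close>

lemma cocycle_eqs_coboundary:
  assumes eqs: "cocycle_eqs g f" and phi0: "\<phi> 0 = 0"
  shows "cocycle_eqs (\<lambda>h l. g h l - \<phi> h - \<phi> l + \<phi> ((h + l) mod N))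
    (\<lambda>h l. f h l + \<phi> l - a ^ nat h * \<phi> l - b * l * a ^ nat h * \<phi> h)"
  unfolding cocycle_eqs_def
proof (intro conjI ballI)
  note E = cocycle_eqsD [OF eqs]
  show "M dvd g 0 0 - \<phi> 0 - \<phi> 0 + \<phi> ((0 + 0) mod N)"
    "M dvd f 0 0 + \<phi> 0 - a ^ nat 0 * \<phi> 0 - b * 0 * a ^ nat 0 * \<phi> 0"
    using E(1,2) phi0 by simp_all
  fix h l assume hl: "h \<in> {0..<N}" "l \<in> {0..<N}"
  show "M dvd g h l - \<phi> h - \<phi> l + \<phi> ((h + l) mod N) - (g l h - \<phi> l - \<phi> h + \<phi> ((l + h) mod N))"
    using E(3) [OF hl] by (simp add: add.commute)
  fix m assume m: "m \<in> {0..<N}"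
  show "M dvd g h l - \<phi> h - \<phi> l + \<phi> ((h + l) mod N)
    + (g ((h + l) mod N) m - \<phi> ((h + l) mod N) - \<phi> m + \<phi> (((h + l) mod N + m) mod N))
    - (g l m - \<phi> l - \<phi> m + \<phi> ((l + m) mod N))
    - (g h ((l + m) mod N) - \<phi> h - \<phi> ((l + m) mod N) + \<phi> ((h + (l + m) mod N) mod N))"
    using E(4) [OF hl m] by (simp add: mod_simps algebra_simps)
  show "M dvd f h l + \<phi> l - a ^ nat h * \<phi> l - b * l * a ^ nat h * \<phi> h
    + (f h m + \<phi> m - a ^ nat h * \<phi> m - b * m * a ^ nat h * \<phi> h)
    - (f h ((l + m) mod N) + \<phi> ((l + m) mod N) - a ^ nat h * \<phi> ((l + m) mod N)
       - b * ((l + m) mod N) * a ^ nat h * \<phi> h)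
    - (a ^ nat h - 1) * (g l m - \<phi> l - \<phi> m + \<phi> ((l + m) mod N))"
    using E(5) [OF hl m] b_mod_N by (rule dvd_coboundary_add)
  show "M dvd f ((h + l) mod N) m + \<phi> m - a ^ nat ((h + l) mod N) * \<phi> m
      - b * m * a ^ nat ((h + l) mod N) * \<phi> ((h + l) mod N)
    + b * a ^ nat h * a ^ nat l * (g h l - \<phi> h - \<phi> l + \<phi> ((h + l) mod N)) * m
    - a ^ nat l * (f h m + \<phi> m - a ^ nat h * \<phi> m - b * m * a ^ nat h * \<phi> h)
    - (f l m + \<phi> m - a ^ nat l * \<phi> m - b * m * a ^ nat l * \<phi> l)
    - b * a ^ nat l * (f h l + \<phi> l - a ^ nat h * \<phi> l - b * l * a ^ nat h * \<phi> h) * m"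
    using E(6) [OF hl m] a_pow_mod_N [OF hl] b_sq by (rule dvd_coboundary_dot)
qed

text \<open>Both conditions arise where an argument wraps around: the first from additivity of f in
  its second argument when the sum reaches N, the second from the recursion in the first argument at
  h = N.\<close>

definition params :: "int \<Rightarrow> int \<Rightarrow> bool" where
  "params \<gamma> f\<^sub>0 \<longleftrightarrow> M dvd N * f\<^sub>0 - (a - 1) * \<gamma> \<and> M dvd geo c (nat N) * f\<^sub>0 - b * \<gamma>"

text \<open>As b^2 = 0, the binomial expansion of (1 + b)^h stops at 1 + h b.\<close>

lemma c_pow: "M dvd c ^ h - a ^ h * (1 + int h * b)"
proof (induction h)
  case (Suc h)
  have "M dvd a * (1 + b) * y - a * z * (1 + (1 + int h) * b)"
    if "M dvd y - z * (1 + int h * b)" for y z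
    using that b_sq by algebra
  from this [OF Suc] show ?case by (simp add: c_def)
qed simp

section \<open>From parameters to cocycles and back\<close>

lemma f_cocycle_cong:
  assumes "h \<in> {0..<N}"
  shows "M dvd f_cocycle p r a b f\<^sub>0 h l - l * geo c (nat h) * f\<^sub>0"
proof -
  define n where "n = nat h"
  \<comment> \<open>Reversing the summation turns the exponents n - j - 1 into j, and the second sum
    may include j = 0, whose term vanishes. Termwise the total is then \<open>l * f\<^sub>0\<close>
    times a^j (1 + j b), which is c^j modulo M.\<close>
  have 1: "(\<Sum>j\<in>{0..<n}. l * a ^ (n - j - 1) * f\<^sub>0) = (\<Sum>j<n. l * a ^ j * f\<^sub>0)"
    by (subst sum.nat_diff_reindex [symmetric]) (simp add: atLeast0LessThan)
  have 2: "(\<Sum>j\<in>{1..<n}. int j * l * b * a ^ j * f\<^sub>0) = (\<Sum>j<n. int j * l * b * a ^ j * f\<^sub>0)"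
    by (rule sum.mono_neutral_left) auto
  have "M dvd (\<Sum>j<n. (l * f\<^sub>0) * (c ^ j - a ^ j * (1 + int j * b)))"
    by (intro dvd_sum dvd_mult c_pow)
  also have "\<dots> = l * geo c n * f\<^sub>0
      - ((\<Sum>j\<in>{0..<n}. l * a ^ (n - j - 1) * f\<^sub>0) + (\<Sum>j\<in>{1..<n}. int j * l * b * a ^ j * f\<^sub>0))"
    unfolding 1 2 geo_def by (simp add: algebra_simps sum_distrib_left sum_subtractf sum.distrib)
  finally have "l * geo c n * f\<^sub>0 mod M = f_cocycle p r a b f\<^sub>0 h l mod M"
    unfolding f_cocycle_def n_def [symmetric] of_nat_power M_fold by (simp only: mod_mod_trivial mod_eq_dvd_iff)
  then show ?thesis by (simp add: n_def flip: mod_eq_dvd_iff)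
qed

lemma f_cocycle_range: "f_cocycle p r a b f\<^sub>0 h l \<in> {0..<M}"
  using M_gt_1 by (simp add: f_cocycle_def)

text \<open>Since \<open>f_cocycle\<close> is reduced modulo M, the equations are verified for its
  closed form as a geometric sum and then transferred.\<close>

lemma cocycle_eqs_cong:
  assumes "cocycle_eqs g f"
    and g: "\<And>h l. \<lbrakk>h \<in> {0..<N}; l \<in> {0..<N}\<rbrakk> \<Longrightarrow> M dvd g' h l - g h l"
    and f: "\<And>h l. \<lbrakk>h \<in> {0..<N}; l \<in> {0..<N}\<rbrakk> \<Longrightarrow> M dvd f' h l - f h l"
  shows "cocycle_eqs g' f'"
  unfolding cocycle_eqs_def
proof (intro conjI ballI)
  note E = cocycle_eqsD [OF assms(1)]
  have modN: "x mod N \<in> {0..<N}" and zero: "0 \<in> {0..<N}" for x using N_gt_1 by simp_all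
  show "M dvd g' 0 0" "M dvd f' 0 0"
    using dvd_add [OF g [OF zero zero] E(1)] dvd_add [OF f [OF zero zero] E(2)] by simp_all
  fix h l assume hl: "h \<in> {0..<N}" "l \<in> {0..<N}"
  show "M dvd g' h l - g' l h"
    by (rule dvd_cong_sym [OF E(3) [OF hl] g [OF hl] g [OF hl(2,1)]])
  fix m assume m: "m \<in> {0..<N}"
  show "M dvd g' h l + g' ((h + l) mod N) m - g' l m - g' h ((l + m) mod N)"
    by (rule dvd_cong_assoc [OF E(4) [OF hl m] g [OF hl] g [OF modN m] g [OF hl(2) m] g [OF hl(1) modN]])
  show "M dvd f' h l + f' h m - f' h ((l + m) mod N) - (a ^ nat h - 1) * g' l m"
    by (rule dvd_cong_add [OF E(5) [OF hl m] f [OF hl] f [OF hl(1) m] f [OF hl(1) modN] g [OF hl(2) m]])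
  show "M dvd f' ((h + l) mod N) m + b * a ^ nat h * a ^ nat l * g' h l * m
     - a ^ nat l * f' h m - f' l m - b * a ^ nat l * f' h l * m"
    by (rule dvd_cong_dot [OF E(6) [OF hl m] f [OF modN m] f [OF hl(1) m] f [OF hl(2) m] f [OF hl] g [OF hl]])
qed

lemma two_cocycle_params:
  assumes "params \<gamma> f\<^sub>0" and "\<gamma> \<in> {0..<M}"
  shows "two_cocycle p \<eta> r a b (alpha_cocycle p \<eta> \<gamma>) (f_cocycle p r a b f\<^sub>0)"
proof (rule two_cocycleI)
  let ?g = "alpha_cocycle p \<eta> \<gamma>" and ?f = "f_cocycle p r a b f\<^sub>0"
  show "?g \<in> {0..<N} \<rightarrow> {0..<N} \<rightarrow> {0..<M}" "?f \<in> {0..<N} \<rightarrow> {0..<N} \<rightarrow> {0..<M}"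
    using assms(2) f_cocycle_range M_gt_1 by (auto simp: alpha_cocycle_def)
  have P: "M dvd N * f\<^sub>0 - (a - 1) * \<gamma>" "M dvd geo c (nat N) * f\<^sub>0 - b * \<gamma>"
    using assms(1) by (simp_all add: params_def)
  have mod_N: "(h + l) mod N = (if h + l \<ge> N then h + l - N else h + l)"
    if "h \<in> {0..<N}" "l \<in> {0..<N}" for h l
    using that mod_pos_pos_trivial [of "h + l - N" N] by (auto simp: mod_pos_pos_trivial)
  \<comment> \<open>N b = 0 gives N c = N a, so [n]_c times \<open>N * f\<^sub>0\<close> equals
    [n]_a (a - 1) \<gamma> = (a^n - 1) \<gamma>. This is additivity of f where the second argument
    wraps around.\<close>
  have geo_pow: "M dvd geo c n * (N * f\<^sub>0) - (a ^ n - 1) * \<gamma>" for n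
  proof (induction n)
    case (Suc n)
    have "M dvd (c * s + 1) * (N * f\<^sub>0) - (a * y - 1) * \<gamma>"
      if "y - 1 = (a - 1) * t" "M dvd s * (N * f\<^sub>0) - (y - 1) * \<gamma>" for s t y
      using that P(1) N_b c_def by algebra
    from this [OF power_diff_geo Suc] show ?case by (simp add: geo_Suc_shift)
  qed simp
  let ?F = "\<lambda>h l. l * geo c (nat h) * f\<^sub>0"
  \<comment> \<open>The law for sums in the first argument, with its common factor m
    removed.\<close>
  have geo_mod: "M dvd geo c (nat ((h + l) mod N)) * f\<^sub>0 + b * a ^ nat h * a ^ nat l * ?g h l
      - a ^ nat l * (1 + l * b) * geo c (nat h) * f\<^sub>0 - geo c (nat l) * f\<^sub>0"
    if hl: "h \<in> {0..<N}" "l \<in> {0..<N}" for h l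
  proof -
    have *: "geo c (nat h + nat l) = c ^ nat l * geo c (nat h) + geo c (nat l)" by (rule geo_add)
    have c: "M dvd c ^ nat l - a ^ nat l * (1 + l * b)" using c_pow [of "nat l"] hl by simp
    show ?thesis
    proof (cases "h + l \<ge> N")
      case False
      then have "nat ((h + l) mod N) = nat h + nat l" using hl mod_N [OF hl] by auto
      moreover have "M dvd (C * G\<^sub>1 + G\<^sub>2) * f\<^sub>0 - A * (1 + l * b) * G\<^sub>1 * f\<^sub>0 - G\<^sub>2 * f\<^sub>0"
        if "M dvd C - A * (1 + l * b)" for C A G\<^sub>1 G\<^sub>2
        using that by algebra
      ultimately show ?thesis
        unfolding alpha_cocycle_def using False * c by simp
    next
      case True
      define k where "k = nat ((h + l) mod N)"
      \<comment> \<open>The sum [N + k]_c is expanded twice, split as N + k and as h + l. As b c^k =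
        b a^k by b^2 = 0, the part c^k [N]_c \<open>f\<^sub>0\<close> = c^k b \<gamma> becomes the
        term with \<alpha>.\<close>
      have "nat h + nat l = nat N + k"
        using True hl N_gt_1 mod_N [OF hl] by (auto simp: k_def)
      with * geo_add [of c "nat N" k]
      have 1: "c ^ k * geo c (nat N) + geo c k = c ^ nat l * geo c (nat h) + geo c (nat l)"
        by simp
      have 2: "M dvd a ^ k - a ^ nat h * a ^ nat l" using a_pow_mod_N [OF hl] by (simp add: k_def)
      have "M dvd G * f\<^sub>0 + b * A\<^sub>1 * A\<^sub>2 * \<gamma> - A\<^sub>2 * (1 + l * b) * G\<^sub>1 * f\<^sub>0 - G\<^sub>2 * f\<^sub>0"
        if G: "C * G\<^sub>0 + G = C\<^sub>2 * G\<^sub>1 + G\<^sub>2" and C\<^sub>2: "M dvd C\<^sub>2 - A\<^sub>2 * (1 + l * b)"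
          and C: "M dvd A - A\<^sub>1 * A\<^sub>2" "M dvd C - A * (1 + n * b)" and G\<^sub>0: "M dvd G\<^sub>0 * f\<^sub>0 - b * \<gamma>"
        for G G\<^sub>0 G\<^sub>1 G\<^sub>2 A A\<^sub>1 A\<^sub>2 C C\<^sub>2 n
      proof -
        have bC: "M dvd b * C - b * (A\<^sub>1 * A\<^sub>2)" using C b_sq by algebra
        have "M dvd (C\<^sub>2 - A\<^sub>2 * (1 + l * b)) * (G\<^sub>1 * f\<^sub>0) - C * (G\<^sub>0 * f\<^sub>0 - b * \<gamma>)
            - (b * C - b * (A\<^sub>1 * A\<^sub>2)) * \<gamma>"
          by (rule dvd_diff [OF dvd_diff [OF dvd_mult2 [OF C\<^sub>2] dvd_mult [OF G\<^sub>0]] dvd_mult2 [OF bC]])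
        also have "\<dots> = G * f\<^sub>0 + b * A\<^sub>1 * A\<^sub>2 * \<gamma> - A\<^sub>2 * (1 + l * b) * G\<^sub>1 * f\<^sub>0 - G\<^sub>2 * f\<^sub>0"
        proof -
          have "G = C\<^sub>2 * G\<^sub>1 + G\<^sub>2 - C * G\<^sub>0" using G by simp
          then show ?thesis by (simp only:) (simp add: algebra_simps)
        qed
        finally show ?thesis .
      qed
      from this [OF 1 c 2 c_pow [of k] P(2)] show ?thesis
        using True by (simp only: alpha_cocycle_def k_def [symmetric] of_nat_power N_fold if_True)
    qed
  qed
  have "cocycle_eqs ?g ?F"
    unfolding cocycle_eqs_def
  proof (intro conjI ballI)
    show "M dvd ?g 0 0" "M dvd ?F 0 0" using N_gt_1 by (simp_all add: alpha_cocycle_def)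
    fix h l assume hl: "h \<in> {0..<N}" "l \<in> {0..<N}"
    show "M dvd ?g h l - ?g l h" by (simp add: alpha_cocycle_def add.commute)
    fix m assume m: "m \<in> {0..<N}"
    show "M dvd ?g h l + ?g ((h + l) mod N) m - ?g l m - ?g h ((l + m) mod N)"
      using hl m by (simp add: alpha_cocycle_def mod_N [OF hl] mod_N [OF hl(2) m])
    show "M dvd ?F h l + ?F h m - ?F h ((l + m) mod N) - (a ^ nat h - 1) * ?g l m"
      using geo_pow [of "nat h"] by (simp add: alpha_cocycle_def mod_N [OF hl(2) m] algebra_simps)
    show "M dvd ?F ((h + l) mod N) m + b * a ^ nat h * a ^ nat l * ?g h l * m
      - a ^ nat l * ?F h m - ?F l m - b * a ^ nat l * ?F h l * m"
      using dvd_mult [OF geo_mod [OF hl], of m] by (simp add: algebra_simps)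
  qed
  then show "cocycle_eqs ?g ?f"
    by (rule cocycle_eqs_cong) (simp_all add: f_cocycle_cong)
qed

text \<open>If g(1, l) vanishes for l < N - 1, the only free value is \<gamma> = g(1, N - 1):
  associativity at (1, h, l) determines g by induction on h. The two laws of the operation then
  determine f from f(1, 1).\<close>

lemma cocycle_eqs_normal_form:
  assumes eqs: "cocycle_eqs g f" and "\<forall>l\<in>{0..<N - 1}. M dvd g 1 l"
  shows "params (g 1 (N - 1)) (f 1 1)"
    and "\<And>h l. \<lbrakk>h \<in> {0..<N}; l \<in> {0..<N}\<rbrakk> \<Longrightarrow> M dvd g h l - alpha_cocycle p \<eta> (g 1 (N - 1)) h l"
    and "\<And>h l. \<lbrakk>h \<in> {0..<N}; l \<in> {0..<N}\<rbrakk> \<Longrightarrow> M dvd f h l - l * geo c (nat h) * f 1 1"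
proof -
  define A where "A h = a ^ nat h" for h
  have A1: "A 1 = a" by (simp add: A_def)
  note E = cocycle_eqsD [OF eqs, folded A_def]
  have mem: "0 \<in> {0..<N}" "1 \<in> {0..<N}" "N - 1 \<in> {0..<N}" using N_gt_1 by auto
  have norm: "M dvd g 1 l" if "0 \<le> l" "l < N - 1" for l
    using assms(2) that by simp
  have norm': "M dvd g l 1" if "0 \<le> l" "l < N - 1" for l
    using E(3) [of l 1] norm [OF that] that mem by (auto simp: dvd_diff_left_iff)
  have g: "M dvd g (int h) l - alpha_cocycle p \<eta> (g 1 (N - 1)) (int h) l"
    if "int h < N" "l \<in> {0..<N}" for h l
    using that
  proof (induction h)
    case 0
    then have "M dvd g 0 0 - g 0 l"
      using E(4) [of 0 0 l] mem by (simp add: mod_pos_pos_trivial)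
    with E(1) have "M dvd g 0 l" by algebra
    then show ?case using 0 by (simp add: alpha_cocycle_def)
  next
    case (Suc h)
    have IH: "M dvd g (int h) l - alpha_cocycle p \<eta> (g 1 (N - 1)) (int h) l" using Suc by simp
    have 1: "M dvd g 1 (int h)" using Suc by (intro norm) auto
    have 2: "M dvd g 1 (int h) + g (1 + int h) l - g (int h) l - g 1 ((int h + l) mod N)"
      using E(4) [of 1 "int h" l] Suc mem by (simp add: mod_pos_pos_trivial)
    \<comment> \<open>The value g(1, h + l) can be nonzero only for h + l = N - 1, exactly where
      \<alpha> jumps from 0 at (h, l) to \<gamma> at (h + 1, l).\<close>
    have 3: "M dvd g 1 ((int h + l) mod N)
        - (alpha_cocycle p \<eta> (g 1 (N - 1)) (1 + int h) l - alpha_cocycle p \<eta> (g 1 (N - 1)) (int h) l)"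
    proof -
      consider "int h + l < N - 1" | "int h + l = N - 1" | "int h + l \<ge> N" by linarith
      then show ?thesis
      proof cases
        case 1
        then show ?thesis using norm [of "int h + l"] Suc
          by (simp add: alpha_cocycle_def mod_pos_pos_trivial)
      next
        case 2
        then have "(int h + l) mod N = N - 1" using N_gt_1 by (simp only: mod_pos_pos_trivial)
        with 2 show ?thesis using Suc by (simp add: alpha_cocycle_def)
      next
        case 3
        then have "(int h + l) mod N = int h + l - N"
          using Suc mod_pos_pos_trivial [of "int h + l - N" N] by simp
        then show ?thesis using norm [of "int h + l - N"] Suc 3 by (simp add: alpha_cocycle_def)
      qed
    qed
    have "M dvd g\<^sub>2 - x"
      if "M dvd g\<^sub>0" "M dvd g\<^sub>0 + g\<^sub>2 - g\<^sub>1 - g\<^sub>3" "M dvd g\<^sub>1 - y" "M dvd g\<^sub>3 - (x - y)" for g\<^sub>0 g\<^sub>1 g\<^sub>2 g\<^sub>3 x y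
      using that by algebra
    from this [OF 1 2 IH 3] show ?case by simp
  qed
  then show "M dvd g h l - alpha_cocycle p \<eta> (g 1 (N - 1)) h l"
    if "h \<in> {0..<N}" "l \<in> {0..<N}" for h l
    using that g [of "nat h" l] by simp
  have f0: "M dvd f h 0" if "h \<in> {0..<N}" for h
  proof -
    have "M dvd f h 0 + f h 0 - f h 0 - (A h - 1) * g 0 0"
      using E(5) [of h 0 0] that mem by simp
    with E(1) show ?thesis by algebra
  qed
  have lin: "M dvd f h (int l) - int l * f h 1" if "h \<in> {0..<N}" "int l < N" for h l
    using that
  proof (induction l)
    case (Suc l)
    have "M dvd f h (int l) + f h 1 - f h (int l + 1) - (A h - 1) * g (int l) 1"
      using E(5) [of h "int l" 1] Suc mem by (simp add: mod_pos_pos_trivial)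
    moreover have "M dvd f h (int l) - int l * f h 1" using Suc by simp
    moreover have "M dvd g (int l) 1" using Suc by (intro norm') auto
    ultimately have "M dvd f h (int l + 1) - (int l + 1) * f h 1" by algebra
    then show ?case by (simp add: add.commute)
  qed (simp add: f0)
  \<comment> \<open>The law for sums in the first argument at (h, 1, 1): f(h + 1, 1) = c f(h, 1) +
    f(1, 1) up to a term with g(h, 1), which matters only at h = N - 1.\<close>
  have step: "M dvd f ((int h + 1) mod N) 1 + b * A (int h) * a * g (int h) 1 - f 1 1 - c * f (int h) 1"
    if "int h < N" for h
  proof -
    have "M dvd f ((int h + 1) mod N) 1 + b * A (int h) * a * g (int h) 1 * 1 - a * f (int h) 1
        - f 1 1 - b * a * f (int h) 1 * 1"
      using E(6) [of "int h" 1 1] that mem unfolding A1 by simp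
    then show ?thesis unfolding c_def by algebra
  qed
  have f01: "M dvd f 0 1"
  proof -
    have "M dvd f 0 1 + b * A 0 * A 0 * g 0 0 * 1 - A 0 * f 0 1 - f 0 1 - b * A 0 * f 0 0 * 1"
      using E(6) [of 0 0 1] mem by simp
    moreover have "A 0 = 1" by (simp add: A_def)
    ultimately show ?thesis using E(1,2) by algebra
  qed
  have geo: "M dvd f (int h) 1 - geo c h * f 1 1" if "int h < N" for h
    using that
  proof (induction h)
    case (Suc h)
    have "M dvd g (int h) 1" using Suc by (intro norm') auto
    moreover have "M dvd f (int h) 1 - geo c h * f 1 1" using Suc by simp
    moreover have "M dvd f (int h + 1) 1 + b * A (int h) * a * g (int h) 1 - f 1 1 - c * f (int h) 1"
      using step [of h] Suc by (simp add: mod_pos_pos_trivial)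
    ultimately have "M dvd f (int h + 1) 1 - (c * geo c h + 1) * f 1 1" by algebra
    then show ?case by (simp add: geo_Suc_shift add.commute)
  qed (simp add: f01)
  show "M dvd f h l - l * geo c (nat h) * f 1 1" if "h \<in> {0..<N}" "l \<in> {0..<N}" for h l
  proof -
    have "M dvd f h l - l * f h 1" "M dvd f h 1 - geo c (nat h) * f 1 1"
      using lin [of h "nat l"] geo [of "nat h"] that by simp_all
    then show ?thesis by algebra
  qed
  have last: "M dvd g (N - 1) 1 - g 1 (N - 1)" using E(3) mem by blast
  \<comment> \<open>Where (N - 1) + 1 wraps around, linearity in the second argument picks up (a -
    1) g(N - 1, 1); this is the first condition of \<open>params\<close>.\<close>
  have "M dvd f 1 (N - 1) + f 1 1 - f 1 0 - (a - 1) * g (N - 1) 1"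
    using E(5) [of 1 "N - 1" 1] mem by (simp add: A1)
  moreover have "M dvd f 1 (N - 1) - (N - 1) * f 1 1"
    using lin [of 1 "nat (N - 1)"] mem by simp
  moreover have "M dvd f 1 0" using f0 mem by blast
  ultimately have 1: "M dvd N * f 1 1 - (a - 1) * g 1 (N - 1)"
    using last by algebra
  \<comment> \<open>The recursion at h = N - 1 returns to f(0, 1) = 0. By a^N = 1 its g-term is b
    \<gamma>, and c [N - 1]_c + 1 = [N]_c; this is the second condition.\<close>
  define n where "n = nat (N - 1)"
  have n: "int n = N - 1" "nat N = Suc n" using N_gt_1 by (auto simp: n_def)
  have "M dvd (c * s + 1) * f 1 1 - b * g 1 (N - 1)"
    if "M dvd f (N - 1) 1 - s * f 1 1"
      "M dvd f 0 1 + b * y * a * g (N - 1) 1 - f 1 1 - c * f (N - 1) 1" "M dvd a * y - 1" for s y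
    using that f01 last by algebra
  moreover have "A (int n) = a ^ n" by (simp add: A_def)
  moreover have "M dvd f (N - 1) 1 - geo c n * f 1 1" using geo [of n] by (simp add: n)
  moreover have "M dvd f 0 1 + b * A (int n) * a * g (N - 1) 1 - f 1 1 - c * f (N - 1) 1"
    using step [of n] by (simp add: n)
  moreover have "M dvd a * a ^ n - 1" using a_pow_N by (simp add: n)
  ultimately have "M dvd geo c (nat N) * f 1 1 - b * g 1 (N - 1)"
    by (simp only: n geo_Suc_shift)
  with 1 show "params (g 1 (N - 1)) (f 1 1)" by (simp add: params_def)
qed

section \<open>The cohomology relation on normalised cocycles\<close>

lemma cohomologousI:
  assumes "\<phi> 0 = 0"
    and "\<And>h l. \<lbrakk>h \<in> {0..<N}; l \<in> {0..<N}\<rbrakk> \<Longrightarrow> M dvd (\<phi> h - \<phi> ((h + l) mod N) + \<phi> l) - (g h l - g' h l)"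
    and "\<And>h l. \<lbrakk>h \<in> {0..<N}; l \<in> {0..<N}\<rbrakk> \<Longrightarrow>
      M dvd (\<phi> l + f h l) - (a ^ nat h * \<phi> l + f' h l + b * l * a ^ nat h * \<phi> h)"
  shows "cohomologous p \<eta> r a b g f g' f'"
proof -
  have 1: "M dvd (y\<^sub>1 - y\<^sub>3 + y\<^sub>2) - g"
    if "M dvd (x\<^sub>1 - x\<^sub>3 + x\<^sub>2) - g" "M dvd y\<^sub>1 - x\<^sub>1" "M dvd y\<^sub>2 - x\<^sub>2" "M dvd y\<^sub>3 - x\<^sub>3"
    for x\<^sub>1 x\<^sub>2 x\<^sub>3 y\<^sub>1 y\<^sub>2 y\<^sub>3 g
    using that by algebra
  have 2: "M dvd (y\<^sub>2 + f) - (A * y\<^sub>2 + f' + b * l * A * y\<^sub>1)"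
    if "M dvd (x\<^sub>2 + f) - (A * x\<^sub>2 + f' + b * l * A * x\<^sub>1)" "M dvd y\<^sub>1 - x\<^sub>1" "M dvd y\<^sub>2 - x\<^sub>2"
    for x\<^sub>1 x\<^sub>2 y\<^sub>1 y\<^sub>2 f f' A l
    using that by algebra
  show ?thesis
    unfolding cohomologous_def carrier_H carrier_I of_nat_power M_fold N_fold cong_iff_dvd_diff
  \<comment> \<open>The given cochain may take arbitrary integer values; it is reduced only here,
    since the equations depend on it modulo M.\<close>
  proof (intro bexI [of _ "\<lambda>h. \<phi> h mod M"] conjI ballI)
    show "\<phi> 0 mod M = 0" by (simp add: assms(1))
    show "(\<lambda>h. \<phi> h mod M) \<in> {0..<N} \<rightarrow> {0..<M}" using M_gt_1 by simp
    fix h l assume hl: "h \<in> {0..<N}" "l \<in> {0..<N}"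
    show "M dvd \<phi> h mod M - \<phi> ((h + l) mod N) mod M + \<phi> l mod M - (g h l - g' h l)"
      by (rule 1 [OF assms(2) [OF hl] dvd_mod_minus dvd_mod_minus dvd_mod_minus])
    show "M dvd \<phi> l mod M + f h l - (a ^ nat h * (\<phi> l mod M) + f' h l + b * l * a ^ nat h * (\<phi> h mod M))"
      by (rule 2 [OF assms(3) [OF hl] dvd_mod_minus dvd_mod_minus])
  qed
qed

lemma cohomologousE:
  assumes "cohomologous p \<eta> r a b g f g' f'"
  obtains \<phi> where "\<phi> 0 = 0"
    and "\<forall>h\<in>{0..<N}. \<forall>l\<in>{0..<N}. M dvd (\<phi> h - \<phi> ((h + l) mod N) + \<phi> l) - (g h l - g' h l)"
    and "\<forall>h\<in>{0..<N}. \<forall>l\<in>{0..<N}.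
      M dvd (\<phi> l + f h l) - (a ^ nat h * \<phi> l + f' h l + b * l * a ^ nat h * \<phi> h)"
proof -
  obtain \<phi> where "\<phi> 0 = 0" and \<phi>: "\<forall>h\<in>{0..<N}. \<forall>l\<in>{0..<N}.
      M dvd (\<phi> h - \<phi> ((h + l) mod N) + \<phi> l) - (g h l - g' h l) \<and>
      M dvd (\<phi> l + f h l) - (a ^ nat h * \<phi> l + f' h l + b * l * a ^ nat h * \<phi> h)"
    using assms
    unfolding cohomologous_def carrier_H carrier_I of_nat_power M_fold N_fold cong_iff_dvd_diff
    by (elim bexE conjE)
  note eqs = \<phi> [THEN bspec, THEN bspec]
  show ?thesis
    by (rule that [of \<phi>, OF \<open>\<phi> 0 = 0\<close>]; intro ballI; rule eqs [THEN conjunct1] eqs [THEN conjunct2])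
qed

lemma cohomologous_sym:
  assumes "cohomologous p \<eta> r a b g f g' f'"
  shows "cohomologous p \<eta> r a b g' f' g f"
proof -
  obtain \<phi> where \<phi>: "\<phi> 0 = 0"
    "\<forall>h\<in>{0..<N}. \<forall>l\<in>{0..<N}. M dvd (\<phi> h - \<phi> ((h + l) mod N) + \<phi> l) - (g h l - g' h l)"
    "\<forall>h\<in>{0..<N}. \<forall>l\<in>{0..<N}.
      M dvd (\<phi> l + f h l) - (a ^ nat h * \<phi> l + f' h l + b * l * a ^ nat h * \<phi> h)"
    using assms by (rule cohomologousE)
  have 1: "M dvd (- x\<^sub>1 - - x\<^sub>3 + - x\<^sub>2) - (g' - g)" if "M dvd (x\<^sub>1 - x\<^sub>3 + x\<^sub>2) - (g - g')" for x\<^sub>1 x\<^sub>2 x\<^sub>3 g g'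
    using that by algebra
  have 2: "M dvd (- x\<^sub>2 + f') - (A * - x\<^sub>2 + f + b * l * A * - x\<^sub>1)"
    if "M dvd (x\<^sub>2 + f) - (A * x\<^sub>2 + f' + b * l * A * x\<^sub>1)" for x\<^sub>1 x\<^sub>2 f f' A l
    using that by algebra
  show ?thesis
    by (rule cohomologousI [of "\<lambda>h. - \<phi> h"]) (simp_all only: \<phi>(1) 1 [OF \<phi>(2) [THEN bspec, THEN bspec]] 2 [OF \<phi>(3) [THEN bspec, THEN bspec]] minus_zero)
qed

lemma cohomologous_trans:
  assumes "cohomologous p \<eta> r a b g f g' f'" and "cohomologous p \<eta> r a b g' f' g'' f''"
  shows "cohomologous p \<eta> r a b g f g'' f''"
proof -
  obtain \<phi> where \<phi>: "\<phi> 0 = 0"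
    "\<forall>h\<in>{0..<N}. \<forall>l\<in>{0..<N}. M dvd (\<phi> h - \<phi> ((h + l) mod N) + \<phi> l) - (g h l - g' h l)"
    "\<forall>h\<in>{0..<N}. \<forall>l\<in>{0..<N}.
      M dvd (\<phi> l + f h l) - (a ^ nat h * \<phi> l + f' h l + b * l * a ^ nat h * \<phi> h)"
    using assms(1) by (rule cohomologousE)
  obtain \<psi> where \<psi>: "\<psi> 0 = 0"
    "\<forall>h\<in>{0..<N}. \<forall>l\<in>{0..<N}. M dvd (\<psi> h - \<psi> ((h + l) mod N) + \<psi> l) - (g' h l - g'' h l)"
    "\<forall>h\<in>{0..<N}. \<forall>l\<in>{0..<N}.
      M dvd (\<psi> l + f' h l) - (a ^ nat h * \<psi> l + f'' h l + b * l * a ^ nat h * \<psi> h)"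
    using assms(2) by (rule cohomologousE)
  have 1: "M dvd ((x\<^sub>1 + y\<^sub>1) - (x\<^sub>3 + y\<^sub>3) + (x\<^sub>2 + y\<^sub>2)) - (g - g'')"
    if "M dvd (x\<^sub>1 - x\<^sub>3 + x\<^sub>2) - (g - g')" "M dvd (y\<^sub>1 - y\<^sub>3 + y\<^sub>2) - (g' - g'')"
    for x\<^sub>1 x\<^sub>2 x\<^sub>3 y\<^sub>1 y\<^sub>2 y\<^sub>3 g g' g''
    using that by algebra
  have 2: "M dvd ((x\<^sub>2 + y\<^sub>2) + f) - (A * (x\<^sub>2 + y\<^sub>2) + f'' + b * l * A * (x\<^sub>1 + y\<^sub>1))"
    if "M dvd (x\<^sub>2 + f) - (A * x\<^sub>2 + f' + b * l * A * x\<^sub>1)" "M dvd (y\<^sub>2 + f') - (A * y\<^sub>2 + f'' + b * l * A * y\<^sub>1)"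
    for x\<^sub>1 x\<^sub>2 y\<^sub>1 y\<^sub>2 f f' f'' A l
    using that by algebra
  show ?thesis
    by (rule cohomologousI [of "\<lambda>h. \<phi> h + \<psi> h"])
      (simp_all only: \<phi>(1) \<psi>(1) 1 [OF \<phi>(2) [THEN bspec, THEN bspec] \<psi>(2) [THEN bspec, THEN bspec]]
        2 [OF \<phi>(3) [THEN bspec, THEN bspec] \<psi>(3) [THEN bspec, THEN bspec]] add_0_left)
qed

lemma params_mod:
  assumes "params \<gamma> f\<^sub>0"
  shows "params (\<gamma> mod M) (f\<^sub>0 mod M)"
proof -
  have "M dvd x * w - y * v" if "M dvd x * w' - y * v'" "M dvd v - v'" "M dvd w - w'" for x y v w v' w'
    using that by algebra
  from this [OF _ dvd_mod_minus dvd_mod_minus] show ?thesis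
    using assms unfolding params_def by blast
qed

text \<open>The cochain \<open>\<phi>\<close> of the proof is chosen so that \<open>g - \<partial>\<phi>\<close> vanishes at \<open>(1, l)\<close> for \<open>l < N - 1\<close>.\<close>

lemma two_cocycle_cohomologous_params:
  assumes "two_cocycle p \<eta> r a b g f"
  obtains \<gamma> f\<^sub>0 where "\<gamma> \<in> {0..<M}" "f\<^sub>0 \<in> {0..<M}" "params \<gamma> f\<^sub>0"
    "cohomologous p \<eta> r a b g f (alpha_cocycle p \<eta> \<gamma>) (f_cocycle p r a b f\<^sub>0)"
proof -
  define \<phi> where "\<phi> h = - (\<Sum>i<nat h. g 1 (int i))" for h
  define g' where "g' h l = g h l - \<phi> h - \<phi> l + \<phi> ((h + l) mod N)" for h l
  define f' where "f' h l = f h l + \<phi> l - a ^ nat h * \<phi> l - b * l * a ^ nat h * \<phi> h" for h l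
  have phi0: "\<phi> 0 = 0" by (simp add: \<phi>_def)
  have eqs: "cocycle_eqs g f" by (rule two_cocycle_eqs [OF assms])
  have eqs': "cocycle_eqs g' f'"
    unfolding g'_def f'_def by (rule cocycle_eqs_coboundary [where \<phi> = \<phi>, OF eqs phi0])
  note E = cocycle_eqsD [OF eqs]
  \<comment> \<open>The differences of \<phi> telescope, so for l < N - 1 the value g'(1, l)
    collapses to -\<phi>(1) = g(1, 0), which vanishes by associativity at (1, 0, 0).\<close>
  have "M dvd g 1 0"
  proof -
    have "M dvd g 1 0 + g 1 0 - g 0 0 - g 1 0"
      using E(4) [of 1 0 0] N_gt_1 by (simp add: mod_pos_pos_trivial)
    with E(1) show ?thesis by algebra
  qed
  have norm: "\<forall>l\<in>{0..<N - 1}. M dvd g' 1 l"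
  proof
    fix l assume "l \<in> {0..<N - 1}"
    then have that: "0 \<le> l" "l < N - 1" by simp_all
    have "nat (1 + l) = Suc (nat l)" using that by simp
    then show "M dvd g' 1 l"
      using that \<open>M dvd g 1 0\<close> by (simp add: g'_def \<phi>_def mod_pos_pos_trivial)
  qed
  note nf = cocycle_eqs_normal_form [OF eqs' norm]
  let ?\<gamma> = "g' 1 (N - 1)" and ?f = "f' 1 1"
  have params: "params (?\<gamma> mod M) (?f mod M)" by (rule params_mod [OF nf(1)])
  have "cohomologous p \<eta> r a b g f (alpha_cocycle p \<eta> (?\<gamma> mod M)) (f_cocycle p r a b (?f mod M))"
  proof (rule cohomologousI [of \<phi>, OF phi0])
    fix h l assume hl: "h \<in> {0..<N}" "l \<in> {0..<N}"
    have "M dvd alpha_cocycle p \<eta> (?\<gamma> mod M) h l - alpha_cocycle p \<eta> ?\<gamma> h l"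
      by (simp add: alpha_cocycle_def dvd_mod_minus)
    moreover have "M dvd (x\<^sub>1 - x\<^sub>3 + x\<^sub>2) - (y - z)"
      if "M dvd z - z'" "M dvd (y - x\<^sub>1 - x\<^sub>2 + x\<^sub>3) - z'" for x\<^sub>1 x\<^sub>2 x\<^sub>3 y z z'
      using that by algebra
    ultimately show "M dvd (\<phi> h - \<phi> ((h + l) mod N) + \<phi> l) - (g h l - alpha_cocycle p \<eta> (?\<gamma> mod M) h l)"
      using nf(2) [OF hl, unfolded g'_def [of h l]] by blast
    have "M dvd f_cocycle p r a b (?f mod M) h l - l * geo c (nat h) * (?f mod M)"
      by (rule f_cocycle_cong [OF hl(1)])
    moreover have "M dvd x\<^sub>2 + y - (A * x\<^sub>2 + z + b * l * A * x\<^sub>1)"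
      if "M dvd z - l * s * f\<^sub>0" "M dvd (y + x\<^sub>2 - A * x\<^sub>2 - b * l * A * x\<^sub>1) - l * s * f\<^sub>0'" "M dvd f\<^sub>0 - f\<^sub>0'"
      for x\<^sub>1 x\<^sub>2 y z s f\<^sub>0 f\<^sub>0' A
      using that by algebra
    ultimately show "M dvd \<phi> l + f h l
        - (a ^ nat h * \<phi> l + f_cocycle p r a b (?f mod M) h l + b * l * a ^ nat h * \<phi> h)"
      using nf(3) [OF hl, unfolded f'_def [of h l]] dvd_mod_minus by blast
  qed
  then show ?thesis
    using that [of "?\<gamma> mod M" "?f mod M"] params M_gt_1 by simp
qed

text \<open>A cochain relating two such cocycles is additive below the wrap around, hence \<phi>(h)
  = h t with t = \<phi>(1). The wrapping pair (N - 1, 1) gives the first congruence, the equation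
  for f at (1, 1) the second.\<close>

lemma cohomologous_params_iff:
  "cohomologous p \<eta> r a b (alpha_cocycle p \<eta> \<gamma>) (f_cocycle p r a b f\<^sub>0)
      (alpha_cocycle p \<eta> \<gamma>') (f_cocycle p r a b f\<^sub>0')
    \<longleftrightarrow> (\<exists>t. M dvd \<gamma> - \<gamma>' - N * t \<and> M dvd f\<^sub>0 - f\<^sub>0' - (c - 1) * t)"
    (is "?coh \<longleftrightarrow> ?ex")
proof
  assume ?coh
  then obtain \<phi> where \<phi>0: "\<phi> 0 = 0"
    and \<phi>: "\<forall>h\<in>{0..<N}. \<forall>l\<in>{0..<N}.
      M dvd (\<phi> h - \<phi> ((h + l) mod N) + \<phi> l) - (alpha_cocycle p \<eta> \<gamma> h l - alpha_cocycle p \<eta> \<gamma>' h l)"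
    "\<forall>h\<in>{0..<N}. \<forall>l\<in>{0..<N}.
      M dvd (\<phi> l + f_cocycle p r a b f\<^sub>0 h l)
        - (a ^ nat h * \<phi> l + f_cocycle p r a b f\<^sub>0' h l + b * l * a ^ nat h * \<phi> h)"
    by (rule cohomologousE)
  have lin: "M dvd \<phi> (int h) - int h * \<phi> 1" if "int h < N" for h
    using that
  proof (induction h)
    case (Suc h)
    have "M dvd (\<phi> (int h) - \<phi> (int h + 1) + \<phi> 1) - 0"
      using \<phi>(1) [THEN bspec, THEN bspec, of "int h" 1] Suc N_gt_1 by (simp add: alpha_cocycle_def mod_pos_pos_trivial)
    moreover have "M dvd \<phi> (int h) - int h * \<phi> 1" using Suc by simp
    moreover have "M dvd z - (1 + n) * y" if "M dvd (x - z + y) - 0" "M dvd x - n * y" for x y z n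
      using that by algebra
    ultimately show ?case by (metis add.commute of_nat_Suc)
  qed (simp add: \<phi>0)
  have "M dvd \<phi> (N - 1) + \<phi> 1 - (\<gamma> - \<gamma>')"
    using \<phi>(1) [THEN bspec, THEN bspec, of "N - 1" 1] N_gt_1 by (simp add: alpha_cocycle_def \<phi>0)
  moreover have "M dvd \<phi> (N - 1) - (N - 1) * \<phi> 1"
    using lin [of "nat (N - 1)"] N_gt_1 by simp
  moreover have "M dvd g - N * y" if "M dvd x + y - g" "M dvd x - (N - 1) * y" for x y g
    using that by algebra
  ultimately have 1: "M dvd \<gamma> - \<gamma>' - N * \<phi> 1" by blast
  have one: "1 \<in> {0..<N}" using N_gt_1 by simp
  have "M dvd x - x' - (c - 1) * y"
    if "M dvd (y + z) - (a * y + z' + b * 1 * a * y)" "M dvd z - x" "M dvd z' - x'" for x x' y z z'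
    using that c_def by algebra
  moreover have "M dvd (\<phi> 1 + f_cocycle p r a b f\<^sub>0 1 1) - (a * \<phi> 1 + f_cocycle p r a b f\<^sub>0' 1 1 + b * 1 * a * \<phi> 1)"
    using \<phi>(2) [THEN bspec, THEN bspec, OF one one] by simp
  moreover have "M dvd f_cocycle p r a b x 1 1 - x" for x
    using f_cocycle_cong [OF one, of x 1] by simp
  ultimately have "M dvd f\<^sub>0 - f\<^sub>0' - (c - 1) * \<phi> 1" by blast
  with 1 show ?ex by blast
next
  assume ?ex
  then obtain t where t: "M dvd \<gamma> - \<gamma>' - N * t" "M dvd f\<^sub>0 - f\<^sub>0' - (c - 1) * t" by blast
  show ?coh
  proof (rule cohomologousI [of "\<lambda>h. h * t"])
    fix h l assume hl: "h \<in> {0..<N}" "l \<in> {0..<N}"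
    have "(h + l) mod N = (if h + l \<ge> N then h + l - N else h + l)"
      using hl mod_pos_pos_trivial [of "h + l - N" N] by (auto simp: mod_pos_pos_trivial)
    then show "M dvd (h * t - (h + l) mod N * t + l * t)
        - (alpha_cocycle p \<eta> \<gamma> h l - alpha_cocycle p \<eta> \<gamma>' h l)"
      using t(1) by (simp add: alpha_cocycle_def algebra_simps dvd_diff_commute)
    \<comment> \<open>With C = c^h and s = [h]_c, the coboundary changes f by l t (a^h (1 + h b) -
      1), which is l t (c - 1) [h]_c modulo M.\<close>
    have "M dvd l * t + x - (A * (l * t) + x' + b * l * A * (h * t))"
      if "M dvd x - l * s * f\<^sub>0" "M dvd x' - l * s * f\<^sub>0'" "C - 1 = (c - 1) * s" "M dvd C - A * (1 + h * b)"
      for x x' s A C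
    proof -
      have "M dvd (x - l * s * f\<^sub>0) - (x' - l * s * f\<^sub>0') + l * s * (f\<^sub>0 - f\<^sub>0' - (c - 1) * t)
          + l * t * (C - A * (1 + h * b))"
        by (intro dvd_add dvd_diff dvd_mult that t)
      moreover have "C = 1 + (c - 1) * s" using that(3) by simp
      ultimately show ?thesis by (simp add: algebra_simps)
    qed
    from this [OF f_cocycle_cong [OF hl(1)] f_cocycle_cong [OF hl(1)] power_diff_geo] c_pow [of "nat h"] hl
    show "M dvd l * t + f_cocycle p r a b f\<^sub>0 h l
        - (a ^ nat h * (l * t) + f_cocycle p r a b f\<^sub>0' h l + b * l * a ^ nat h * (h * t))"
      by simp
  qed simp
qed

text \<open>Turns the classification into a question on pairs: every cocycle is cohomologous to one
  given by a pair in \<open>params\<close>, and on these the relation is congruence modulo multiples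
  of (N, c - 1).\<close>

lemma complete_parameter_setI:
  assumes range: "P \<subseteq> {0..<M} \<times> {0..<M}" and params: "\<And>\<gamma> f\<^sub>0. (\<gamma>, f\<^sub>0) \<in> P \<Longrightarrow> params \<gamma> f\<^sub>0"
    and unique: "\<And>\<gamma> f\<^sub>0. \<lbrakk>params \<gamma> f\<^sub>0; \<gamma> \<in> {0..<M}; f\<^sub>0 \<in> {0..<M}\<rbrakk> \<Longrightarrow>
      \<exists>!x. x \<in> P \<and> (\<exists>t. M dvd \<gamma> - fst x - N * t \<and> M dvd f\<^sub>0 - snd x - (c - 1) * t)"
  shows "complete_parameter_set p \<eta> r a b P"
  unfolding complete_parameter_set_def carrier_I
proof (intro conjI allI impI)
  show "P \<subseteq> {0..<M} \<times> {0..<M}" by (rule range)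
  show "\<forall>(\<gamma>, f\<^sub>0)\<in>P. two_cocycle p \<eta> r a b (alpha_cocycle p \<eta> \<gamma>) (f_cocycle p r a b f\<^sub>0)"
    using two_cocycle_params params range by blast
  fix g f assume "two_cocycle p \<eta> r a b g f"
  then obtain \<gamma> f\<^sub>0 where \<gamma>: "\<gamma> \<in> {0..<M}" "f\<^sub>0 \<in> {0..<M}" "params \<gamma> f\<^sub>0"
    and coh: "cohomologous p \<eta> r a b g f (alpha_cocycle p \<eta> \<gamma>) (f_cocycle p r a b f\<^sub>0)"
    by (rule two_cocycle_cohomologous_params)
  have "cohomologous p \<eta> r a b g f (alpha_cocycle p \<eta> \<gamma>') (f_cocycle p r a b f\<^sub>0') \<longleftrightarrow>
      (\<exists>t. M dvd \<gamma> - \<gamma>' - N * t \<and> M dvd f\<^sub>0 - f\<^sub>0' - (c - 1) * t)" for \<gamma>' f\<^sub>0'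
    using cohomologous_trans [OF coh] cohomologous_trans [OF cohomologous_sym [OF coh]]
    unfolding cohomologous_params_iff [symmetric] by blast
  then show "\<exists>!x. x \<in> P \<and> (case x of (\<gamma>, f\<^sub>0) \<Rightarrow>
      cohomologous p \<eta> r a b g f (alpha_cocycle p \<eta> \<gamma>) (f_cocycle p r a b f\<^sub>0))"
    using unique [OF \<gamma>(3,1,2)] by (simp add: case_prod_unfold)
qed

end

section \<open>Valuations and geometric sums of length a power of \<open>p\<close>\<close>

text \<open>The \<open>p\<close>-adic valuation of the class of \<open>x\<close> in \<open>\<int>/p\<^sup>r\<close>, with value \<open>r\<close> for the zero class.\<close>

definition is_val :: "nat \<Rightarrow> nat \<Rightarrow> int \<Rightarrow> nat \<Rightarrow> bool" where
  "is_val p r x v \<longleftrightarrow> v \<le> r \<and> (\<forall>i\<le>r. int p ^ i dvd x \<longleftrightarrow> i \<le> v)"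

lemma is_valI:
  assumes "v \<le> r" "int p ^ v dvd x" "v < r \<Longrightarrow> \<not> int p ^ Suc v dvd x"
  shows "is_val p r x v"
  unfolding is_val_def
proof (intro conjI allI impI iffI)
  show "v \<le> r" by fact
  fix i assume i: "i \<le> r"
  show "i \<le> v" if "int p ^ i dvd x"
  proof (rule ccontr)
    assume "\<not> i \<le> v"
    then have "int p ^ Suc v dvd int p ^ i" "v < r" using i le_imp_power_dvd [of "Suc v" i "int p"] by auto
    then show False using assms(3) that dvd_trans by blast
  qed
  show "int p ^ i dvd x" if "i \<le> v"
    using assms(2) that le_imp_power_dvd dvd_trans by blast
qed

text \<open>Links the description of q and q' as largest exponents to \<open>is_val\<close>; the
  bound by r keeps the set finite also for x = 0.\<close>

lemma is_val_Max: "is_val p r x (Max {i. i \<le> r \<and> int p ^ i dvd x})"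
proof -
  let ?S = "{i. i \<le> r \<and> int p ^ i dvd x}"
  have fin: "finite ?S" by (rule finite_subset [of _ "{..r}"]) auto
  have "0 \<in> ?S" by simp
  then have "Max ?S \<in> ?S" using fin by (intro Max_in) auto
  moreover have ge: "i \<le> Max ?S" if "i \<le> r" "int p ^ i dvd x" for i
    using that by (intro Max_ge [OF fin]) simp
  have "\<not> int p ^ Suc (Max ?S) dvd x" if "Max ?S < r"
  proof
    assume "int p ^ Suc (Max ?S) dvd x"
    with that have "Suc (Max ?S) \<le> Max ?S" by (intro ge) auto
    then show False by simp
  qed
  ultimately show ?thesis by (intro is_valI) simp_all
qed

lemma is_val_dvd: "is_val p r x v \<Longrightarrow> i \<le> v \<Longrightarrow> int p ^ i dvd x"
  by (auto simp: is_val_def)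

lemma is_val_le: "is_val p r x v \<Longrightarrow> v \<le> r"
  by (simp add: is_val_def)

lemma is_val_geI: "is_val p r x v \<Longrightarrow> i \<le> r \<Longrightarrow> int p ^ i dvd x \<Longrightarrow> i \<le> v"
  by (simp add: is_val_def)

lemma is_val_unique: "is_val p r x v \<Longrightarrow> is_val p r x w \<Longrightarrow> v = w"
  unfolding is_val_def by (meson dual_order.refl le_antisym)

lemma is_val_mult_unit:
  assumes "coprime y (int p)"
  shows "is_val p r (y * x) v \<longleftrightarrow> is_val p r x v"
proof -
  have "int p ^ i dvd y * x \<longleftrightarrow> int p ^ i dvd x" for i
    using assms by (intro coprime_dvd_mult_right_iff) (simp add: coprime_commute)
  then show ?thesis by (simp add: is_val_def)
qed

lemma is_val_add:
  assumes x: "is_val p r x v" and y: "is_val p r y w" and "v < w"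
  shows "is_val p r (x + y) v"
  unfolding is_val_def
proof (intro conjI allI impI iffI)
  show "v \<le> r" using x by (rule is_val_le)
  fix i assume i: "i \<le> r"
  show "i \<le> v" if "int p ^ i dvd x + y"
  proof (rule ccontr)
    assume "\<not> i \<le> v"
    then have "int p ^ Suc v dvd x + y" using that by (meson dvd_trans le_imp_power_dvd not_less_eq_eq)
    moreover have "int p ^ Suc v dvd y" using y \<open>v < w\<close> by (intro is_val_dvd) auto
    ultimately have "int p ^ Suc v dvd x" using dvd_add_left_iff by blast
    then have "Suc v \<le> v" using x y \<open>v < w\<close> by (intro is_val_geI [OF x]) (auto dest: is_val_le)
    then show False by simp
  qed
  show "int p ^ i dvd x + y" if "i \<le> v"
    using that \<open>v < w\<close> by (intro dvd_add is_val_dvd [OF x] is_val_dvd [OF y]) auto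
qed

lemma is_val_diff:
  assumes "is_val p r x v" and "is_val p r y w" and "v < w"
  shows "is_val p r (x - y) v"
  using is_val_add [of p r x v "- y" w] assms by (simp add: is_val_def)

lemma is_val_cong:
  assumes "int p ^ r dvd x - y"
  shows "is_val p r x v \<longleftrightarrow> is_val p r y v"
proof -
  have "int p ^ i dvd x \<longleftrightarrow> int p ^ i dvd y" if "i \<le> r" for i
    using assms that by (meson dvd_diff_left_iff dvd_diff_right_iff dvd_trans le_imp_power_dvd)
  then show ?thesis by (auto simp: is_val_def)
qed

lemma is_val_power_mult:
  assumes "prime p" "v < r" "\<not> int p dvd y"
  shows "is_val p r (int p ^ v * y) v"
  using assms by (intro is_valI) auto

text \<open>For v < r the cofactor of p^v in x is prime to p, so y has to supply the missing power
  of p.\<close>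

lemma is_val_mult_dvd:
  assumes "prime p" and x: "is_val p r x v" and "int p ^ r dvd x * y"
  shows "int p ^ (r - v) dvd y"
proof (cases "v < r")
  case True
  obtain z where z: "x = int p ^ v * z" using is_val_dvd [OF x order_refl] by blast
  have "\<not> int p dvd z"
  proof
    assume "int p dvd z"
    then have "int p ^ Suc v dvd x" unfolding z by (simp add: mult.commute mult_dvd_mono)
    then show False using is_val_geI [OF x, of "Suc v"] True by simp
  qed
  then have "coprime (int p ^ (r - v)) z"
    using assms(1) by (simp add: prime_imp_coprime)
  moreover have "int p ^ v * int p ^ (r - v) dvd int p ^ v * (z * y)"
    using assms(3) True by (simp add: z mult.assoc flip: power_add)
  then have "int p ^ (r - v) dvd z * y" using assms(1) by (simp add: prime_gt_0_nat)
  ultimately show ?thesis by (simp add: coprime_dvd_mult_right_iff)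
qed (use is_val_le [OF x] in simp)

section \<open>Geometric sums for odd p\<close>

lemma eq_of_dvd_diff:
  fixes n x y :: int
  assumes "n dvd x - y" "0 \<le> x" "x < n" "0 \<le> y" "y < n"
  shows "x = y"
  using assms by (metis mod_eq_dvd_iff mod_pos_pos_trivial)

text \<open>The linear part of the binomial expansion of (1 + (w - 1))^j; all further terms contain
  the square of w - 1.\<close>

lemma power_first_order: "m * m dvd w ^ j - 1 - int j * (w - 1)" if "m dvd w - 1" for m w :: int
proof (induction j)
  case (Suc j)
  have "m * m dvd w * y - 1 - (1 + n) * (w - 1)" if "m * m dvd y - 1 - n * (w - 1)" for y n
  proof -
    have "m * m dvd (w - 1) * (w - 1)" using \<open>m dvd w - 1\<close> by (simp add: mult_dvd_mono)
    then have "m * m dvd w * (y - 1 - n * (w - 1)) + n * ((w - 1) * (w - 1))" using that by simp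
    then show ?thesis by (simp add: algebra_simps)
  qed
  from this [OF Suc] show ?case by simp
qed simp

text \<open>Summing the first order expansions over j < p leaves the linear term (w - 1) p (p - 1) /
  2, where (p - 1) / 2 is an integer as p is odd. The quadratic errors are divisible by m p because
  p divides m.\<close>

lemma geo_odd:
  fixes m w :: int
  assumes "odd p" and "m dvd w - 1" and "int p dvd m"
  shows "m * int p dvd geo w p - int p"
proof -
  have "m * int p dvd m * m" using assms(3) by (simp add: mult_dvd_mono)
  then have "m * int p dvd (\<Sum>j<p. w ^ j - 1 - int j * (w - 1))"
    using power_first_order [OF assms(2)] by (intro dvd_sum) (blast intro: dvd_trans)
  moreover have "(\<Sum>j<p. int j) = int p * (int (p - 1) div 2)"
  proof -
    have "2 * (\<Sum>j<n. int j) = int n * (int n - 1)" for n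
      by (induction n) (auto simp: algebra_simps)
    moreover have "2 * (int (p - 1) div 2) = int p - 1" using \<open>odd p\<close> by (auto elim!: oddE)
    ultimately show ?thesis by (metis mult.left_commute mult_cancel_left zero_neq_numeral)
  qed
  then have "(\<Sum>j<p. w ^ j - 1 - int j * (w - 1))
      = geo w p - int p - (w - 1) * int p * (int (p - 1) div 2)"
    by (simp add: geo_def sum_subtractf mult.commute [of _ "w - 1"] mult.assoc flip: sum_distrib_left)
  moreover have "m * int p dvd (w - 1) * int p * (int (p - 1) div 2)"
    using assms(2) by (intro dvd_mult2 mult_dvd_mono) auto
  ultimately show ?thesis by (metis dvd_diff_left_iff)
qed

text \<open>Induction through [p^(n+1)]_x = [p^n]_x [p]_w with w = x^(p^n). Since w - 1 = (x - 1)
  [p^n]_x is divisible by p^(n+d), \<open>geo_odd\<close> applies with m = p^(n+d).\<close>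

lemma geo_prime_power:
  fixes x :: int
  assumes "odd p" and "d \<ge> 1" and x: "int p ^ d dvd x - 1"
  shows "int p ^ (n + d) dvd geo x (p ^ n) - int p ^ n"
proof (induction n)
  case (Suc n)
  define w where "w = x ^ (p ^ n)"
  obtain s where "geo x (p ^ n) - int p ^ n = int p ^ (n + d) * s" using Suc by (rule dvdE)
  then have s: "geo x (p ^ n) = int p ^ n * (1 + int p ^ d * s)"
    by (simp add: power_add algebra_simps)
  obtain y where y: "x - 1 = int p ^ d * y" using x by (rule dvdE)
  have "w - 1 = int p ^ (n + d) * (y * (1 + int p ^ d * s))"
    unfolding w_def power_diff_geo s y power_add by (simp add: algebra_simps)
  then have "int p ^ (n + d) dvd w - 1" by simp
  then have "int p ^ (n + d) * int p dvd geo w p - int p"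
    using assms by (intro geo_odd) (auto intro: dvd_power)
  then obtain t where "geo w p - int p = int p ^ (n + d) * int p * t" by (rule dvdE)
  then have t: "geo w p = int p + int p ^ (n + d) * int p * t" by simp
  have "geo x (p ^ Suc n) = geo x (p ^ n) * geo w p"
    using geo_mult [of x "p ^ n" p] by (simp add: w_def mult.commute)
  also have "\<dots> - int p ^ Suc n = int p ^ (Suc n + d) * (s * (1 + int p ^ (n + d) * t) + int p ^ n * t)"
    unfolding s t by (simp add: power_add algebra_simps)
  finally show ?case by simp
qed simp

section \<open>Representatives for odd \<open>p\<close>\<close>

lemma dvd_mult_diff_mult:
  fixes M :: "'a :: idom"
  assumes "M dvd w - k * s" and "M dvd D - x * k"
  shows "M dvd x * w - D * s"
  using assms by algebra

text \<open>As c - 1 = b a + a - 1, the last two assumptions say that c - 1 and p^q generate the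
  same ideal modulo M.\<close>

locale odd_cyclic_extension = cyclic_extension +
  fixes q :: nat and k'' :: int
  assumes prime_p: "prime p" and odd_p: "odd p" and eta_less_r: "\<eta> < r"
    and dvd_a: "int p ^ (r - \<eta>) dvd a - 1"
    and q_le: "q \<le> r" and coprime_k: "coprime k'' (int p)"
    and c_minus_1: "M dvd (c - 1) - int p ^ q * k''"
begin

section \<open>The group of parameters and the coboundaries in it\<close>

lemma M_split: "i \<le> r \<Longrightarrow> M = int p ^ i * int p ^ (r - i)"
  and N_split: "i \<le> \<eta> \<Longrightarrow> N = int p ^ i * int p ^ (\<eta> - i)"
  unfolding M_def N_def power_add [symmetric] by simp_all

lemma M_eq: "M = int p ^ (r - \<eta>) * N"
  using M_split [of \<eta>] eta_less_r by (simp add: mult.commute)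

lemma N_dvd_M: "N dvd M" by (simp add: M_eq)

lemma dvd_b: "int p ^ (r - \<eta>) dvd b"
  using N_b N_gt_1 by (simp add: M_eq mult.commute)

lemma dvd_c: "int p ^ (r - \<eta>) dvd c - 1"
proof -
  have "c - 1 = (a - 1) + a * b" by (simp add: c_def algebra_simps)
  also have "int p ^ (r - \<eta>) dvd (a - 1) + a * b" by (intro dvd_add dvd_a dvd_mult dvd_b)
  finally show ?thesis .
qed

lemma geo_c: "M dvd geo c (nat N) - N"
  using geo_prime_power [OF odd_p _ dvd_c, of \<eta>] eta_less_r by (simp add: nat_N)

text \<open>Multiplying the first condition by b and using N b = 0 gives b (a - 1) \<gamma> = 0, so
  b \<gamma> = b a \<gamma>. As [N]_c = N modulo M, replacing \<open>N * f\<^sub>0\<close> by (a -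
  1) \<gamma> turns the second condition into one on \<gamma> alone.\<close>

lemma params_iff: "params \<gamma> f\<^sub>0 \<longleftrightarrow> M dvd N * f\<^sub>0 - (a - 1) * \<gamma> \<and> M dvd (b * a - a + 1) * \<gamma>"
proof -
  have "M dvd geo c (nat N) * f\<^sub>0 - b * \<gamma> \<longleftrightarrow> M dvd (b * a - a + 1) * \<gamma>"
    if Nf: "M dvd N * f\<^sub>0 - (a - 1) * \<gamma>"
  proof -
    have ba: "M dvd b * (a - 1) * \<gamma>" using Nf N_b by algebra
    have "geo c (nat N) * f\<^sub>0 - b * \<gamma> = (geo c (nat N) - N) * f\<^sub>0 + (N * f\<^sub>0 - (a - 1) * \<gamma>)
        + b * (a - 1) * \<gamma> - (b * a - a + 1) * \<gamma>"
      by (simp add: algebra_simps)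
    moreover have "M dvd (geo c (nat N) - N) * f\<^sub>0 + (N * f\<^sub>0 - (a - 1) * \<gamma>) + b * (a - 1) * \<gamma>"
      by (intro dvd_add dvd_mult2 geo_c Nf ba)
    ultimately show ?thesis by (simp only: dvd_diff_right_iff)
  qed
  then show ?thesis by (auto simp: params_def)
qed

lemma params_lin:
  assumes "params \<gamma> f\<^sub>0" "params \<gamma>' f\<^sub>0'"
  shows "params (x * \<gamma> + y * \<gamma>') (x * f\<^sub>0 + y * f\<^sub>0')"
proof -
  have "M dvd s * (x * f\<^sub>0 + y * f\<^sub>0') - z * (x * \<gamma> + y * \<gamma>')"
    if "M dvd s * f\<^sub>0 - z * \<gamma>" "M dvd s * f\<^sub>0' - z * \<gamma>'" for s z
    using that by algebra
  then show ?thesis using assms unfolding params_def by blast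
qed

lemma params_coboundary: "params N (c - 1)"
proof -
  have "M dvd N * (c - 1)" using dvd_c by (simp add: M_eq mult.commute mult_dvd_mono)
  moreover have "M dvd N * (a - 1)" using dvd_a by (simp add: M_eq mult.commute mult_dvd_mono)
  moreover have "N * (c - 1) - (a - 1) * N = N * (c - 1) - N * (a - 1)"
    "(b * a - a + 1) * N = a * (N * b) - N * (a - 1)" by (simp_all add: algebra_simps)
  ultimately show ?thesis using N_b unfolding params_iff by (simp only: dvd_diff dvd_mult)
qed

lemma params_0_iff: "params 0 f\<^sub>0 \<longleftrightarrow> int p ^ (r - \<eta>) dvd f\<^sub>0"
  using N_gt_1 by (simp add: params_iff M_eq mult.commute)

lemma k_inverse: obtains s where "M dvd x - k'' * s"
proof -
  have "coprime k'' M" using coprime_k unfolding M_def by (simp del: M_fold)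
  then obtain k' where "[k'' * k' = 1] (mod M)" using cong_solve_coprime_int by blast
  then have "M dvd 1 - k'' * k'" by (simp add: cong_iff_dvd_diff dvd_diff_commute)
  then have "M dvd x - k'' * (k' * x)" by algebra
  then show ?thesis by (rule that)
qed

text \<open>The members are the combinations of (\<open>c\<^sub>1\<close>, \<open>c\<^sub>2\<close>)
  and (0, \<open>c\<^sub>3\<close>), so completeness means that each parameter has exactly one pair
  of coordinates in the given ranges modulo multiples of (N, c - 1).\<close>

lemma param_setI:
  assumes c: "params c\<^sub>1 c\<^sub>2" "params 0 c\<^sub>3"
    and ex: "\<And>\<gamma> f\<^sub>0. params \<gamma> f\<^sub>0 \<Longrightarrow> \<exists>z\<^sub>1 z\<^sub>2 t. 0 \<le> z\<^sub>1 \<and> z\<^sub>1 < int n\<^sub>1 \<and> 0 \<le> z\<^sub>2 \<and> z\<^sub>2 < int n\<^sub>2 \<and>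
      M dvd \<gamma> - c\<^sub>1 * z\<^sub>1 - N * t \<and> M dvd f\<^sub>0 - (c\<^sub>2 * z\<^sub>1 + c\<^sub>3 * z\<^sub>2) - (c - 1) * t"
    and unique: "\<And>z\<^sub>1 z\<^sub>2 z\<^sub>1' z\<^sub>2' t. \<lbrakk>0 \<le> z\<^sub>1; z\<^sub>1 < int n\<^sub>1; 0 \<le> z\<^sub>2; z\<^sub>2 < int n\<^sub>2;
      0 \<le> z\<^sub>1'; z\<^sub>1' < int n\<^sub>1; 0 \<le> z\<^sub>2'; z\<^sub>2' < int n\<^sub>2;
      M dvd c\<^sub>1 * (z\<^sub>1 - z\<^sub>1') - N * t; M dvd c\<^sub>2 * (z\<^sub>1 - z\<^sub>1') + c\<^sub>3 * (z\<^sub>2 - z\<^sub>2') - (c - 1) * t\<rbrakk>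
      \<Longrightarrow> z\<^sub>1 = z\<^sub>1' \<and> z\<^sub>2 = z\<^sub>2'"
  shows "complete_parameter_set p \<eta> r a b (param_set p r c\<^sub>1 c\<^sub>2 c\<^sub>3 n\<^sub>1 n\<^sub>2)"
proof (rule complete_parameter_setI)
  let ?P = "param_set p r c\<^sub>1 c\<^sub>2 c\<^sub>3 n\<^sub>1 n\<^sub>2"
  show "?P \<subseteq> {0..<M} \<times> {0..<M}" using M_gt_1 by (auto simp: param_set_def)
  show "params \<gamma> f\<^sub>0" if "(\<gamma>, f\<^sub>0) \<in> ?P" for \<gamma> f\<^sub>0
  proof -
    from that obtain z\<^sub>1 z\<^sub>2 where "\<gamma> = (z\<^sub>1 * c\<^sub>1 + z\<^sub>2 * 0) mod M" "f\<^sub>0 = (z\<^sub>1 * c\<^sub>2 + z\<^sub>2 * c\<^sub>3) mod M"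
      by (auto simp: param_set_def mult.commute)
    then show ?thesis using params_mod [OF params_lin [OF c]] by simp
  qed
  fix \<gamma> f\<^sub>0 assume "params \<gamma> f\<^sub>0"
  then obtain z\<^sub>1 z\<^sub>2 t where z: "0 \<le> z\<^sub>1" "z\<^sub>1 < int n\<^sub>1" "0 \<le> z\<^sub>2" "z\<^sub>2 < int n\<^sub>2"
    and t: "M dvd \<gamma> - c\<^sub>1 * z\<^sub>1 - N * t" "M dvd f\<^sub>0 - (c\<^sub>2 * z\<^sub>1 + c\<^sub>3 * z\<^sub>2) - (c - 1) * t"
    using ex by blast
  have red: "M dvd x - y mod M - z \<longleftrightarrow> M dvd x - y - z" for x y z
  proof -
    have "x - y mod M - z = (x - y - z) - (y mod M - y)" by simp
    then show ?thesis by (simp only: dvd_diff_left_iff dvd_mod_minus)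
  qed
  show "\<exists>!x. x \<in> ?P \<and> (\<exists>t. M dvd \<gamma> - fst x - N * t \<and> M dvd f\<^sub>0 - snd x - (c - 1) * t)"
  proof (rule ex1I [of _ "((c\<^sub>1 * z\<^sub>1) mod M, (c\<^sub>2 * z\<^sub>1 + c\<^sub>3 * z\<^sub>2) mod M)"], goal_cases)
    case 1
    have "((c\<^sub>1 * z\<^sub>1) mod M, (c\<^sub>2 * z\<^sub>1 + c\<^sub>3 * z\<^sub>2) mod M) \<in> ?P"
      using z by (auto simp: param_set_def)
    then show ?case using t by (auto simp: red)
  next
    case (2 x)
    then obtain z\<^sub>1' z\<^sub>2' t' where x: "x = ((c\<^sub>1 * z\<^sub>1') mod M, (c\<^sub>2 * z\<^sub>1' + c\<^sub>3 * z\<^sub>2') mod M)"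
      and z': "0 \<le> z\<^sub>1'" "z\<^sub>1' < int n\<^sub>1" "0 \<le> z\<^sub>2'" "z\<^sub>2' < int n\<^sub>2"
      and "M dvd \<gamma> - fst x - N * t'" "M dvd f\<^sub>0 - snd x - (c - 1) * t'"
      by (auto simp: param_set_def)
    then have t': "M dvd \<gamma> - c\<^sub>1 * z\<^sub>1' - N * t'" "M dvd f\<^sub>0 - (c\<^sub>2 * z\<^sub>1' + c\<^sub>3 * z\<^sub>2') - (c - 1) * t'"
      by (simp_all add: red)
    have "M dvd c\<^sub>1 * (z\<^sub>1 - z\<^sub>1') - N * (t' - t)" using t(1) t'(1) by algebra
    moreover have "M dvd c\<^sub>2 * (z\<^sub>1 - z\<^sub>1') + c\<^sub>3 * (z\<^sub>2 - z\<^sub>2') - (c - 1) * (t' - t)"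
      using t(2) t'(2) by algebra
    ultimately have "z\<^sub>1 = z\<^sub>1' \<and> z\<^sub>2 = z\<^sub>2'" by (rule unique [OF z z'])
    then show ?case by (simp add: x)
  qed
qed

lemma p_pow_dvd_c: "int p ^ i dvd c - 1" if "i \<le> q"
proof -
  have "int p ^ i dvd M" unfolding M_def using that q_le by (intro le_imp_power_dvd) simp
  then have "int p ^ i dvd (c - 1) - int p ^ q * k''" using c_minus_1 dvd_trans by blast
  moreover have "int p ^ i dvd int p ^ q * k''" using that by (simp add: le_imp_power_dvd)
  ultimately show ?thesis using dvd_diff_left_iff by blast
qed

text \<open>
  Here a representative is found by reducing \<open>\<gamma>\<close> modulo the first component \<open>p\<^sup>\<eta>\<close> of the
  coboundary \<open>(p\<^sup>\<eta>, c - 1)\<close>, and then \<open>f\<^sub>0\<close> by the coboundaries with vanishing first component.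
\<close>

lemma complete_by_first_component:
  assumes e: "e \<le> \<eta>" and c\<^sub>2: "params (int p ^ e) c\<^sub>2"
    and gamma: "\<And>\<gamma> f\<^sub>0. params \<gamma> f\<^sub>0 \<Longrightarrow> int p ^ e dvd \<gamma>"
  shows "complete_parameter_set p \<eta> r a b
    (param_set p r (int p ^ e) c\<^sub>2 (int p ^ (r - \<eta>)) (p ^ (\<eta> - e)) (p ^ min q \<eta>))"
proof (rule param_setI)
  define m where "m = min q \<eta>"
  have N_eq: "N = int p ^ e * int p ^ (\<eta> - e)" using e by (rule N_split)
  show "params (int p ^ e) c\<^sub>2" by (rule c\<^sub>2)
  show "params 0 (int p ^ (r - \<eta>))" by (simp add: params_0_iff)
  show "\<exists>z\<^sub>1 z\<^sub>2 t. 0 \<le> z\<^sub>1 \<and> z\<^sub>1 < int (p ^ (\<eta> - e)) \<and> 0 \<le> z\<^sub>2 \<and> z\<^sub>2 < int (p ^ min q \<eta>) \<and>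
      M dvd \<gamma> - int p ^ e * z\<^sub>1 - N * t \<and> M dvd f\<^sub>0 - (c\<^sub>2 * z\<^sub>1 + int p ^ (r - \<eta>) * z\<^sub>2) - (c - 1) * t"
    if par: "params \<gamma> f\<^sub>0" for \<gamma> f\<^sub>0
  proof -
    obtain w where w: "\<gamma> = int p ^ e * w" using gamma [OF par] by blast
    define z\<^sub>1 where "z\<^sub>1 = w mod int p ^ (\<eta> - e)"
    define t\<^sub>0 where "t\<^sub>0 = w div int p ^ (\<eta> - e)"
    have "w = z\<^sub>1 + int p ^ (\<eta> - e) * t\<^sub>0" by (simp add: z\<^sub>1_def t\<^sub>0_def)
    then have g: "\<gamma> - int p ^ e * z\<^sub>1 - N * t\<^sub>0 = 0" unfolding w N_eq by (simp add: algebra_simps)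
    \<comment> \<open>Once the first component is 0, the second one is a multiple of p^(r -
      \<eta>).\<close>
    have "params (\<gamma> - int p ^ e * z\<^sub>1 - N * t\<^sub>0) (f\<^sub>0 - c\<^sub>2 * z\<^sub>1 - (c - 1) * t\<^sub>0)"
      using params_lin [OF params_lin [OF par c\<^sub>2, of 1 "- z\<^sub>1"] params_coboundary, of 1 "- t\<^sub>0"]
      by (simp add: mult.commute)
    then obtain w\<^sub>2 where w\<^sub>2: "f\<^sub>0 - c\<^sub>2 * z\<^sub>1 - (c - 1) * t\<^sub>0 = int p ^ (r - \<eta>) * w\<^sub>2"
      unfolding g params_0_iff by blast
    define z\<^sub>2 where "z\<^sub>2 = w\<^sub>2 mod int p ^ m"
    have w\<^sub>2': "w\<^sub>2 - z\<^sub>2 = int p ^ m * (w\<^sub>2 div int p ^ m)"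
      by (simp add: z\<^sub>2_def minus_mod_eq_mult_div)
    \<comment> \<open>Modulo N the multiples of c - 1 are those of p^m: for q \<le> \<eta> because
      k'' is a unit, otherwise because c - 1 vanishes modulo N.\<close>
    have "\<exists>s. N dvd w\<^sub>2 - z\<^sub>2 - (c - 1) * s"
    proof (cases "q \<le> \<eta>")
      case True
      obtain s where s: "M dvd w\<^sub>2 div int p ^ m - k'' * s" by (rule k_inverse)
      have "m = q" using True by (simp add: m_def)
      then have "M dvd w\<^sub>2 - z\<^sub>2 - (c - 1) * s"
        using dvd_mult_diff_mult [OF s c_minus_1] w\<^sub>2' by simp
      then show ?thesis using N_dvd_M dvd_trans by blast
    next
      case False
      then have "N dvd w\<^sub>2 - z\<^sub>2 - (c - 1) * 0" using w\<^sub>2' by (simp add: m_def)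
      then show ?thesis by blast
    qed
    then obtain s where "N dvd w\<^sub>2 - z\<^sub>2 - (c - 1) * s" by blast
    then have s: "M dvd int p ^ (r - \<eta>) * (w\<^sub>2 - z\<^sub>2 - (c - 1) * s)" by (simp add: M_eq)
    \<comment> \<open>A multiple of p^(r - \<eta>) added to the factor changes \<gamma> only by a
      multiple of p^(r - \<eta>) N = M.\<close>
    define t where "t = t\<^sub>0 + int p ^ (r - \<eta>) * s"
    have "\<gamma> - int p ^ e * z\<^sub>1 - N * t = - (M * s)"
      using g by (simp add: t_def M_eq algebra_simps)
    moreover have "f\<^sub>0 - (c\<^sub>2 * z\<^sub>1 + int p ^ (r - \<eta>) * z\<^sub>2) - (c - 1) * t
        = int p ^ (r - \<eta>) * (w\<^sub>2 - z\<^sub>2 - (c - 1) * s)"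
      using w\<^sub>2 by (simp add: t_def algebra_simps)
    moreover have "0 \<le> z\<^sub>1" "z\<^sub>1 < int (p ^ (\<eta> - e))" "0 \<le> z\<^sub>2" "z\<^sub>2 < int (p ^ min q \<eta>)"
      using p_gt_1 by (simp_all add: z\<^sub>1_def z\<^sub>2_def m_def)
    ultimately show ?thesis using s by (metis dvd_minus_iff dvd_triv_left)
  qed
  fix z\<^sub>1 z\<^sub>2 z\<^sub>1' z\<^sub>2' t
  assume z: "0 \<le> z\<^sub>1" "z\<^sub>1 < int (p ^ (\<eta> - e))" "0 \<le> z\<^sub>2" "z\<^sub>2 < int (p ^ min q \<eta>)"
    "0 \<le> z\<^sub>1'" "z\<^sub>1' < int (p ^ (\<eta> - e))" "0 \<le> z\<^sub>2'" "z\<^sub>2' < int (p ^ min q \<eta>)"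
    and t: "M dvd int p ^ e * (z\<^sub>1 - z\<^sub>1') - N * t"
      "M dvd c\<^sub>2 * (z\<^sub>1 - z\<^sub>1') + int p ^ (r - \<eta>) * (z\<^sub>2 - z\<^sub>2') - (c - 1) * t"
  have "N dvd int p ^ e * (z\<^sub>1 - z\<^sub>1') - N * t" using N_dvd_M t(1) dvd_trans by blast
  then have "N dvd int p ^ e * (z\<^sub>1 - z\<^sub>1')" using dvd_diff_left_iff dvd_triv_left by blast
  then have "int p ^ (\<eta> - e) dvd z\<^sub>1 - z\<^sub>1'" using p_gt_1 by (simp add: N_eq)
  then have 1: "z\<^sub>1 = z\<^sub>1'" using z by (intro eq_of_dvd_diff) auto
  \<comment> \<open>For equal first coordinates the coboundary has vanishing first component, so its
    factor is a multiple of p^(r - \<eta>).\<close>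
  then have "int p ^ (r - \<eta>) dvd t" using t(1) N_gt_1 by (simp add: M_eq mult.commute)
  then obtain s where "t = int p ^ (r - \<eta>) * s" by blast
  then have "M dvd int p ^ (r - \<eta>) * (z\<^sub>2 - z\<^sub>2' - (c - 1) * s)"
    using t(2) 1 by (simp add: algebra_simps)
  then have "N dvd z\<^sub>2 - z\<^sub>2' - (c - 1) * s" using p_gt_1 by (simp add: M_eq)
  moreover have "int p ^ m dvd N" unfolding N_def m_def by (intro le_imp_power_dvd) simp
  ultimately have "int p ^ m dvd z\<^sub>2 - z\<^sub>2' - (c - 1) * s" by (rule dvd_trans [rotated])
  moreover have "int p ^ m dvd (c - 1) * s" by (intro dvd_mult2 p_pow_dvd_c) (simp add: m_def)
  ultimately have "int p ^ m dvd z\<^sub>2 - z\<^sub>2'" using dvd_diff_left_iff by blast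
  then have "z\<^sub>2 = z\<^sub>2'" using z by (intro eq_of_dvd_diff) (auto simp: m_def)
  with 1 show "z\<^sub>1 = z\<^sub>1' \<and> z\<^sub>2 = z\<^sub>2'" by simp
qed

text \<open>
  If \<open>q < \<eta>\<close>, one can instead reduce \<open>f\<^sub>0\<close> modulo \<open>p\<^sup>q\<close> first; this leaves only coboundaries that
  vanish.
\<close>

lemma complete_by_second_component:
  assumes q: "q < \<eta>" "r - \<eta> \<le> q" and q': "q' \<le> r" "r - \<eta> \<le> q'"
    and a: "M dvd (a - 1) * int p ^ (r - q')" and par0: "params (int p ^ (r - q')) 0"
    and gamma: "\<And>\<gamma> f\<^sub>0. params \<gamma> f\<^sub>0 \<Longrightarrow> int p ^ (r - q') dvd \<gamma>"
  shows "complete_parameter_set p \<eta> r a b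
    (param_set p r (int p ^ (r - q')) 0 (int p ^ (r - \<eta>)) (p ^ q') (p ^ (q + \<eta> - r)))"
proof (rule param_setI)
  define n where "n = q + \<eta> - r"
  have pq: "int p ^ q = int p ^ (r - \<eta>) * int p ^ n"
    using q eta_less_r by (simp add: n_def flip: power_add)
  have M_eq': "M = int p ^ (r - q') * int p ^ q'" using M_split [OF q'(1)] by (simp add: mult.commute)
  have N_eq: "N = int p ^ (r - q') * int p ^ (\<eta> - (r - q'))"
    using q' by (intro N_split) simp
  show "params (int p ^ (r - q')) 0" by (rule par0)
  show "params 0 (int p ^ (r - \<eta>))" by (simp add: params_0_iff)
  show "\<exists>z\<^sub>1 z\<^sub>2 t. 0 \<le> z\<^sub>1 \<and> z\<^sub>1 < int (p ^ q') \<and> 0 \<le> z\<^sub>2 \<and> z\<^sub>2 < int (p ^ (q + \<eta> - r)) \<and>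
      M dvd \<gamma> - int p ^ (r - q') * z\<^sub>1 - N * t \<and> M dvd f\<^sub>0 - (0 * z\<^sub>1 + int p ^ (r - \<eta>) * z\<^sub>2) - (c - 1) * t"
    if par: "params \<gamma> f\<^sub>0" for \<gamma> f\<^sub>0
  proof -
    obtain w\<^sub>1 where w\<^sub>1: "\<gamma> = int p ^ (r - q') * w\<^sub>1" using gamma [OF par] by blast
    have "params (\<gamma> - w\<^sub>1 * int p ^ (r - q')) f\<^sub>0"
      using params_lin [OF par par0, of 1 "- w\<^sub>1"] by simp
    then obtain w\<^sub>2 where w\<^sub>2: "f\<^sub>0 = int p ^ (r - \<eta>) * w\<^sub>2"
      by (auto simp: w\<^sub>1 params_0_iff)
    define z\<^sub>2 where "z\<^sub>2 = w\<^sub>2 mod int p ^ n"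
    have "w\<^sub>2 - z\<^sub>2 = int p ^ n * (w\<^sub>2 div int p ^ n)"
      by (simp add: z\<^sub>2_def minus_mod_eq_mult_div)
    then have f: "f\<^sub>0 - int p ^ (r - \<eta>) * z\<^sub>2 = int p ^ q * (w\<^sub>2 div int p ^ n)"
      by (simp add: w\<^sub>2 pq flip: right_diff_distrib)
    \<comment> \<open>As c - 1 is p^q times a unit modulo M, some factor t removes the quotient part
      of \<open>f\<^sub>0\<close> and leaves the remainder \<open>z\<^sub>2\<close>.\<close>
    obtain t where t: "M dvd w\<^sub>2 div int p ^ n - k'' * t" by (rule k_inverse)
    have 2: "M dvd f\<^sub>0 - (0 * z\<^sub>1 + int p ^ (r - \<eta>) * z\<^sub>2) - (c - 1) * t" for z\<^sub>1
      using dvd_mult_diff_mult [OF t c_minus_1] f by simp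
    \<comment> \<open>The coboundary spent on \<open>f\<^sub>0\<close> also shifts \<gamma> by N t;
      v is the coordinate of \<gamma> after this shift.\<close>
    define v where "v = w\<^sub>1 - int p ^ (\<eta> - (r - q')) * t"
    have "\<gamma> - int p ^ (r - q') * (v mod int p ^ q') - N * t = int p ^ (r - q') * (v - v mod int p ^ q')"
      by (simp add: w\<^sub>1 v_def N_eq algebra_simps)
    also have "\<dots> = M * (v div int p ^ q')"
      by (simp add: M_eq' minus_mod_eq_mult_div)
    finally have 1: "M dvd \<gamma> - int p ^ (r - q') * (v mod int p ^ q') - N * t" by simp
    have "0 \<le> v mod int p ^ q'" "v mod int p ^ q' < int (p ^ q')" "0 \<le> z\<^sub>2" "z\<^sub>2 < int (p ^ (q + \<eta> - r))"
      using p_gt_1 by (simp_all add: z\<^sub>2_def n_def)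
    with 1 2 show ?thesis by blast
  qed
  fix z\<^sub>1 z\<^sub>2 z\<^sub>1' z\<^sub>2' t
  assume z: "0 \<le> z\<^sub>1" "z\<^sub>1 < int (p ^ q')" "0 \<le> z\<^sub>2" "z\<^sub>2 < int (p ^ (q + \<eta> - r))"
    "0 \<le> z\<^sub>1'" "z\<^sub>1' < int (p ^ q')" "0 \<le> z\<^sub>2'" "z\<^sub>2' < int (p ^ (q + \<eta> - r))"
    and t: "M dvd int p ^ (r - q') * (z\<^sub>1 - z\<^sub>1') - N * t"
      "M dvd 0 * (z\<^sub>1 - z\<^sub>1') + int p ^ (r - \<eta>) * (z\<^sub>2 - z\<^sub>2') - (c - 1) * t"
  have "int p ^ q dvd M" unfolding M_def using q_le by (rule le_imp_power_dvd)
  then have "int p ^ q dvd int p ^ (r - \<eta>) * (z\<^sub>2 - z\<^sub>2') - (c - 1) * t"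
    using t(2) by (simp add: dvd_trans)
  moreover have "int p ^ q dvd (c - 1) * t" using p_pow_dvd_c by simp
  ultimately have "int p ^ q dvd int p ^ (r - \<eta>) * (z\<^sub>2 - z\<^sub>2')" using dvd_diff_left_iff by blast
  then have "int p ^ n dvd z\<^sub>2 - z\<^sub>2'" using p_gt_1 by (simp add: pq)
  then have 2: "z\<^sub>2 = z\<^sub>2'" using z by (intro eq_of_dvd_diff) (auto simp: n_def)
  then have "M dvd (c - 1) * t" using t(2) by simp
  have "M dvd x * k * t" if "M dvd D * t" "M dvd D - x * k" for D x k
    using that by algebra
  from this [OF \<open>M dvd (c - 1) * t\<close> c_minus_1] have "M dvd int p ^ q * k'' * t" .
  moreover have "M = int p ^ q * int p ^ (r - q)" using q_le by (rule M_split)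
  ultimately have "int p ^ (r - q) dvd k'' * t" using p_gt_1 by (simp add: mult.assoc)
  then have "int p ^ (r - q) dvd t"
    using coprime_k by (simp add: coprime_commute coprime_dvd_mult_right_iff)
  \<comment> \<open>A coboundary with vanishing second component has a factor divisible by p^(r -
    q); as q < \<eta>, its first component vanishes too.\<close>
  moreover have "M dvd N * int p ^ (r - q)"
    unfolding M_def N_def power_add [symmetric] using q by (intro le_imp_power_dvd) simp
  ultimately have "M dvd N * t" by (meson dvd_trans dvd_refl mult_dvd_mono)
  then have "M dvd int p ^ (r - q') * (z\<^sub>1 - z\<^sub>1')" using t(1) dvd_diff_left_iff by blast
  then have "int p ^ q' dvd z\<^sub>1 - z\<^sub>1'" using p_gt_1 by (simp add: M_eq')
  then have "z\<^sub>1 = z\<^sub>1'" using z by (intro eq_of_dvd_diff) auto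
  with 2 show "z\<^sub>1 = z\<^sub>1' \<and> z\<^sub>2 = z\<^sub>2'" by simp
qed

end

lemma is_val_restrict: "is_val p r x v \<Longrightarrow> v \<le> s \<Longrightarrow> s \<le> r \<Longrightarrow> is_val p s x v"
  by (auto simp: is_val_def)

text \<open>In the application v is r - \<eta> + u, which gives v = r for a = 1.\<close>

locale valued_extension = odd_cyclic_extension +
  fixes \<beta> q' v :: nat and k' :: int
  assumes val_q: "is_val p r (b * a + a - 1) q"
    and val_q': "is_val p r (b * a - a + 1) q'"
    and val_b: "is_val p r b \<beta>"
    and val_a: "is_val p r (a - 1) v"
    and b_eq: "M dvd b - int p ^ \<beta> * k'"
begin

section \<open>Comparing the valuations\<close>

lemma val_ba: "is_val p r (b * a) \<beta>"
proof -
  have "coprime a (int p)" using a_coprime r_pos by (simp add: M_def del: M_fold)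
  then show ?thesis using val_b by (simp add: is_val_mult_unit mult.commute)
qed

lemma coprime_2: "coprime 2 (int p)"
  using odd_p by simp

lemma bounds: "r - \<eta> \<le> \<beta>" "r - \<eta> \<le> v" "r - \<eta> \<le> q" "r - \<eta> \<le> q'" "q' \<le> r"
proof -
  have ba: "int p ^ (r - \<eta>) dvd b * a" using dvd_b by simp
  have "b * a + a - 1 = b * a + (a - 1)" "b * a - a + 1 = b * a - (a - 1)" by simp_all
  then have "int p ^ (r - \<eta>) dvd b * a + a - 1" "int p ^ (r - \<eta>) dvd b * a - a + 1"
    using ba dvd_a by (simp_all only: dvd_add dvd_diff)
  then show "r - \<eta> \<le> \<beta>" "r - \<eta> \<le> v" "r - \<eta> \<le> q" "r - \<eta> \<le> q'"
    using dvd_a dvd_b by (auto intro: is_val_geI [OF val_b] is_val_geI [OF val_a] is_val_geI [OF val_q] is_val_geI [OF val_q'])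
  show "q' \<le> r" using val_q' by (rule is_val_le)
qed

lemma val_2a: "is_val p r (2 * (a - 1)) v" and val_2ba: "is_val p r (2 * (b * a)) \<beta>"
  using val_a val_ba by (simp_all only: is_val_mult_unit [OF coprime_2])

text \<open>From a - 1 = b a - (b a - a + 1) and b a + a - 1 = 2 (a - 1) + (b a - a + 1): in both,
  the last term has the larger valuation q'. Doubling preserves valuations as p is odd.\<close>

lemma v_eq_beta: "v = \<beta>" and q_eq_beta: "q = \<beta>" if "\<beta> < q'"
proof -
  have "is_val p r (b * a - (b * a - a + 1)) \<beta>"
    using that by (intro is_val_diff [OF val_ba val_q'])
  then show "v = \<beta>" using is_val_unique [OF val_a] by simp
  have "is_val p r (2 * (a - 1) + (b * a - a + 1)) \<beta>"
    using that \<open>v = \<beta>\<close> val_2a by (intro is_val_add [OF _ val_q']) simp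
  then show "q = \<beta>" using is_val_unique [OF val_q] by (simp add: algebra_simps)
qed

lemma q'_le_v: "q' \<le> v" if "q' \<le> \<beta>"
proof -
  have "int p ^ q' dvd b * a - (b * a - a + 1)"
    using that by (intro dvd_diff is_val_dvd [OF val_ba] is_val_dvd [OF val_q']) auto
  then show ?thesis using bounds(5) by (intro is_val_geI [OF val_a]) simp_all
qed

lemma q_eq_v: "q = v" if "q < \<beta>"
proof -
  have "is_val p r ((b * a + a - 1) - b * a) q"
    using that by (intro is_val_diff [OF val_q val_ba])
  then show ?thesis using is_val_unique [OF val_a] by simp
qed

text \<open>The sum of b a + a - 1 and b a - a + 1 is 2 b a and their difference is 2 (a - 1); if q
  and q' differ, both results have the smaller valuation.\<close>

lemma less_cases:
  shows "q < q' \<Longrightarrow> v = q \<and> \<beta> = q" and "q' < q \<Longrightarrow> v = q' \<and> \<beta> = q'" and "q = q' \<Longrightarrow> q \<le> \<beta>"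
proof -
  have eq: "(b * a + a - 1) - (b * a - a + 1) = 2 * (a - 1)" "(b * a + a - 1) + (b * a - a + 1) = 2 * (b * a)"
    "- ((b * a - a + 1) - (b * a + a - 1)) = 2 * (a - 1)" "(b * a - a + 1) + (b * a + a - 1) = 2 * (b * a)"
    by simp_all
  have minus: "is_val p r (- x) w \<longleftrightarrow> is_val p r x w" for x w by (simp add: is_val_def)
  show "v = q \<and> \<beta> = q" if "q < q'"
    using is_val_diff [OF val_q val_q' that] is_val_add [OF val_q val_q' that]
      is_val_unique [OF val_2a] is_val_unique [OF val_2ba] unfolding eq by blast
  show "v = q' \<and> \<beta> = q'" if "q' < q"
    using is_val_diff [OF val_q' val_q that, THEN minus [THEN iffD2]] is_val_add [OF val_q' val_q that]
      is_val_unique [OF val_2a] is_val_unique [OF val_2ba] unfolding eq by blast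
  show "q \<le> \<beta>" if "q = q'"
  proof (intro is_val_geI [OF val_2ba q_le])
    show "int p ^ q dvd 2 * (b * a)"
      unfolding eq(2) [symmetric] using that
      by (intro dvd_add is_val_dvd [OF val_q] is_val_dvd [OF val_q']) auto
  qed
qed

section \<open>Generators of the parameters and the individual cases\<close>

lemma params_dvd_gamma: "params \<gamma> f\<^sub>0 \<Longrightarrow> int p ^ (r - q') dvd \<gamma>"
  using is_val_mult_dvd [OF prime_p val_q'] by (simp add: params_iff)

lemma is_val_mult_power: "M dvd x * int p ^ i" if "is_val p r x w" "r \<le> w + i"
proof -
  have "int p ^ r dvd int p ^ w * int p ^ i"
    unfolding power_add [symmetric] using that(2) by (rule le_imp_power_dvd)
  also have "\<dots> dvd x * int p ^ i" by (rule mult_dvd_mono [OF is_val_dvd [OF that(1) order_refl] dvd_refl])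
  finally show ?thesis by simp
qed

text \<open>For q' \<le> v the element p^(r - q') is killed by a - 1 as well as by b a - a +
  1.\<close>

lemma params_power_0: "params (int p ^ (r - q')) 0" if "q' \<le> v"
  using that bounds(5) is_val_mult_power [OF val_a, of "r - q'"] is_val_mult_power [OF val_q', of "r - q'"]
  by (simp add: params_iff)

text \<open>Multiplying the hypothesis on x by b gives b a x = b x, so (a - 1) x = b a x = b x, and
  b is p^\<beta> k' modulo M.\<close>

lemma params_power:
  assumes x: "M dvd (b * a - a + 1) * x" and y: "M dvd N * y - int p ^ \<beta> * k' * x"
  shows "params x y"
proof -
  have "M dvd z - (a - 1) * x" if "M dvd z - w * x" "M dvd b - w" for z w
    using that x b_sq by algebra
  from this [OF y b_eq] show ?thesis using x by (simp add: params_iff)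
qed

text \<open>Here (a - 1) x is written as (c - 1) x - b x, which brings in both k'' and k'.\<close>

lemma params_power':
  assumes x: "M dvd (b * a - a + 1) * x" and y: "M dvd N * y - (int p ^ q * k'' - int p ^ \<beta> * k') * x"
  shows "params x y"
proof -
  have bx: "M dvd b * (a - 1) * x" using x b_sq by algebra
  have "M dvd z - (a - 1) * x" if "M dvd z - (w - w') * x" "M dvd b - w'" "M dvd (c - 1) - w" for z w w'
  proof -
    have "M dvd (z - (w - w') * x) - ((c - 1) - w) * x + (b - w') * x + b * (a - 1) * x"
      by (rule dvd_add [OF dvd_add [OF dvd_diff [OF that(1) dvd_mult2 [OF that(3)]] dvd_mult2 [OF that(2)]] bx])
    then show ?thesis by (simp add: c_def algebra_simps)
  qed
  from this [OF y b_eq c_minus_1] show ?thesis using x by (simp add: params_iff)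
qed

lemma first_component:
  assumes "params (int p ^ (r - q')) c\<^sub>2"
  shows "complete_parameter_set p \<eta> r a b
    (param_set p r (int p ^ (r - q')) c\<^sub>2 (int p ^ (r - \<eta>)) (p ^ (\<eta> + q' - r)) (p ^ min q \<eta>))"
proof -
  have "\<eta> - (r - q') = \<eta> + q' - r" "r - q' \<le> \<eta>" using bounds(4,5) by auto
  then show ?thesis
    using complete_by_first_component [OF _ assms params_dvd_gamma] by simp
qed

lemma second_component:
  assumes "q < \<eta>" "q' \<le> v"
  shows "complete_parameter_set p \<eta> r a b
    (param_set p r (int p ^ (r - q')) 0 (int p ^ (r - \<eta>)) (p ^ q') (p ^ (q + \<eta> - r)))"
  using assms bounds is_val_mult_power [OF val_a, of "r - q'"]
  by (intro complete_by_second_component params_power_0 params_dvd_gamma) simp_all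

lemma complete_II_le:
  assumes "\<eta> \<le> q" "q' \<le> \<beta>"
  shows "complete_parameter_set p \<eta> r a b
    (param_set p r (int p ^ (r - q')) 0 (int p ^ (r - \<eta>)) (p ^ (\<eta> + q' - r)) (p ^ \<eta>))"
  using first_component [OF params_power_0 [OF q'_le_v [OF assms(2)]]] assms(1) by (simp add: min_absorb2)

text \<open>As q = \<beta> \<ge> \<eta>, the factor N can be divided out of p^\<beta> (k'' - k')
  p^(r - q'), which gives the second component of the generator.\<close>

lemma complete_II_gt:
  assumes "\<eta> \<le> q" "\<beta> < q'"
  shows "complete_parameter_set p \<eta> r a b
    (param_set p r (int p ^ (r - q')) (int p ^ (r - q' + \<beta> - \<eta>) * (k'' - k'))
      (int p ^ (r - \<eta>)) (p ^ (\<eta> + q' - r)) (p ^ \<eta>))"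
proof -
  have q: "q = \<beta>" using q_eq_beta [OF assms(2)] .
  have "N * int p ^ (r - q' + \<beta> - \<eta>) = int p ^ (r - q') * int p ^ \<beta>"
    unfolding N_def power_add [symmetric] using assms(1) q by simp
  then have "N * (int p ^ (r - q' + \<beta> - \<eta>) * (k'' - k'))
      = (int p ^ q * k'' - int p ^ \<beta> * k') * int p ^ (r - q')"
    by (simp add: q algebra_simps)
  then have "params (int p ^ (r - q')) (int p ^ (r - q' + \<beta> - \<eta>) * (k'' - k'))"
    using bounds(5) by (intro params_power' is_val_mult_power [OF val_q']) auto
  from first_component [OF this] show ?thesis using assms(1) by (simp add: min_absorb2)
qed

text \<open>The second component solves N y = p^\<beta> k' p^(r - q'); the bound on q' is what makes
  the exponent of p in y nonnegative.\<close>

lemma complete_III_le: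
  assumes "q < \<eta>" "q = \<beta>" "\<beta> < q'" "q' \<le> r - \<eta> + \<beta>"
  shows "complete_parameter_set p \<eta> r a b
    (param_set p r (int p ^ (r - q')) (int p ^ (r + \<beta> - q' - \<eta>) * k')
      (int p ^ (r - \<eta>)) (p ^ (\<eta> + q' - r)) (p ^ q))"
proof -
  have "\<eta> + (r + \<beta> - q' - \<eta>) = \<beta> + (r - q')" using assms(4) bounds(5) eta_less_r by simp
  then have "N * int p ^ (r + \<beta> - q' - \<eta>) = int p ^ \<beta> * int p ^ (r - q')"
    unfolding N_def power_add [symmetric] by (simp only:)
  then have "N * (int p ^ (r + \<beta> - q' - \<eta>) * k') = int p ^ \<beta> * k' * int p ^ (r - q')"
    by (simp add: algebra_simps)
  then have "params (int p ^ (r - q')) (int p ^ (r + \<beta> - q' - \<eta>) * k')"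
    using bounds(5) by (intro params_power is_val_mult_power [OF val_q']) (simp_all only: diff_self, simp_all)
  from first_component [OF this] show ?thesis using assms(1) by (simp add: min_absorb1)
qed

text \<open>Divisibility of \<gamma> by p^(r - q') is not sharp for so large q'. Modulo N the first
  condition reads (a - 1) \<gamma> = 0, and a - 1 has valuation \<beta> < \<eta>, so p^(\<eta> -
  \<beta>) divides \<gamma>, where \<eta> - \<beta> > r - q'.\<close>

lemma complete_III_gt:
  assumes "q < \<eta>" "q = \<beta>" "\<beta> < q'" "q' > r - \<eta> + \<beta>"
  shows "complete_parameter_set p \<eta> r a b
    (param_set p r (int p ^ (\<eta> - \<beta>)) k' (int p ^ (r - \<eta>)) (p ^ \<beta>) (p ^ \<beta>))"
proof -
  have v: "is_val p \<eta> (a - 1) \<beta>"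
    using val_a v_eq_beta [OF assms(3)] assms(1,2) eta_less_r by (auto intro: is_val_restrict)
  have gamma: "int p ^ (\<eta> - \<beta>) dvd \<gamma>" if "params \<gamma> f\<^sub>0" for \<gamma> f\<^sub>0
  proof -
    have "N dvd N * f\<^sub>0 - (a - 1) * \<gamma>" using that N_dvd_M dvd_trans by (auto simp: params_def)
    then have "int p ^ \<eta> dvd (a - 1) * \<gamma>" by (simp add: dvd_diff_right_iff)
    then show ?thesis by (rule is_val_mult_dvd [OF prime_p v])
  qed
  have "N * k' = int p ^ \<beta> * k' * int p ^ (\<eta> - \<beta>)"
    using N_split [of \<beta>] assms(1,2) by (simp add: algebra_simps)
  then have "params (int p ^ (\<eta> - \<beta>)) k'"
    using assms by (intro params_power is_val_mult_power [OF val_q']) auto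
  from complete_by_first_component [OF _ this gamma] show ?thesis
    using assms(1,2) by (simp add: min_absorb1)
qed

end

section \<open>The case \<open>p = 2\<close>\<close>

lemma ex1_bounded: "(\<exists>!x. x \<in> S \<and> Q x) \<longleftrightarrow> (\<exists>x\<in>S. Q x \<and> (\<forall>y\<in>S. Q y \<longrightarrow> y = x))"
  by blast

lemma range_4: "x \<in> {0..<4} \<longleftrightarrow> x = 0 \<or> x = 1 \<or> x = 2 \<or> x = 3" for x :: int
  by auto

text \<open>Here M = 4, N = 2 and [2]_c = 1 + c. The factor t of a coboundary matters only modulo 4,
  so each case is a finite check over residues.\<close>

lemma complete_parameter_set_2:
  assumes "admissible_pair 2 1 2 a b"
  shows "(b, a) \<in> {(0, 1), (0, 3), (2, 1), (2, 3)}"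
    and "(b, a) = (0, 1) \<Longrightarrow> complete_parameter_set 2 1 2 a b {(0, 0), (0, 2), (1, 0), (1, 2)}"
    and "(b, a) = (0, 3) \<Longrightarrow> complete_parameter_set 2 1 2 a b {(0, 0), (2, 0), (1, 1), (3, 1)}"
    and "(b, a) = (2, 1) \<Longrightarrow> complete_parameter_set 2 1 2 a b {(0, 0), (2, 0)}"
    and "(b, a) = (2, 3) \<Longrightarrow> complete_parameter_set 2 1 2 a b {(0, 0), (2, 2), (1, 1), (3, 3)}"
proof -
  interpret cyclic_extension 2 "Suc 0" 2 a b
    using assms by unfold_locales auto
  have N: "N = 2" and M: "M = 4" unfolding N_def M_def by (simp_all del: N_fold M_fold)
  have par: "params x y \<longleftrightarrow> 4 dvd 2 * y - (a - 1) * x \<and> 4 dvd (1 + c) * y - b * x" for x y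
  proof -
    have "geo c 2 = 1 + c" by (simp add: numeral_2_eq_2 geo_Suc)
    then show ?thesis by (simp add: params_def M N)
  qed
  have t4: "(\<exists>t. 4 dvd x - 2 * t \<and> 4 dvd y - d * t) \<longleftrightarrow>
      (\<exists>t\<in>{0, 1, 2, 3}. 4 dvd x - 2 * t \<and> 4 dvd y - d * t)" for x y d :: int
  proof
    assume "\<exists>t. 4 dvd x - 2 * t \<and> 4 dvd y - d * t"
    then obtain t where t: "4 dvd x - 2 * t" "4 dvd y - d * t" by blast
    have "4 dvd z - w * (t mod 4)" if "4 dvd z - w * t" for z w
    proof -
      have "4 dvd (z - w * t) - w * (t mod 4 - t)"
        by (intro dvd_diff that dvd_mult dvd_mod_minus)
      then show ?thesis by (simp add: algebra_simps)
    qed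
    from this [OF t(1)] this [OF t(2)] have "4 dvd x - 2 * (t mod 4)" "4 dvd y - d * (t mod 4)" .
    moreover have "t mod 4 \<in> {0, 1, 2, 3}" using range_4 [of "t mod 4"] by auto
    ultimately show "\<exists>t\<in>{0, 1, 2, 3}. 4 dvd x - 2 * t \<and> 4 dvd y - d * t"
      by (intro bexI [of _ "t mod 4"] conjI)
  qed blast
  have "a \<in> {0..<4}" "b \<in> {0..<4}" using a_range M by simp_all
  moreover have "4 dvd a ^ 2 - 1" "4 dvd 2 * b" using a_pow_N N_b by (simp_all add: M N)
  ultimately show "(b, a) \<in> {(0, 1), (0, 3), (2, 1), (2, 3)}"
    unfolding range_4 by auto
  let ?d = "\<lambda>x y t. 4 dvd x - 2 * t \<and> 4 dvd y - (a * (1 + b) - 1) * t"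
  let ?R = "\<lambda>\<gamma> f x. \<exists>t\<in>{0, 1, 2, 3}. ?d (\<gamma> - fst x) (f - snd x) t"
  have complete: "complete_parameter_set 2 1 2 a b P"
    if range: "P \<subseteq> {0, 1, 2, 3} \<times> {0, 1, 2, 3}"
      and params: "\<forall>(\<gamma>, f\<^sub>0)\<in>P. 4 dvd 2 * f\<^sub>0 - (a - 1) * \<gamma> \<and> 4 dvd (1 + a * (1 + b)) * f\<^sub>0 - b * \<gamma>"
      and unique: "\<forall>\<gamma>\<in>{0, 1, 2, 3}. \<forall>f\<^sub>0\<in>{0, 1, 2, 3}.
        4 dvd 2 * f\<^sub>0 - (a - 1) * \<gamma> \<and> 4 dvd (1 + a * (1 + b)) * f\<^sub>0 - b * \<gamma> \<longrightarrow>
        (\<exists>x\<in>P. ?R \<gamma> f\<^sub>0 x \<and> (\<forall>y\<in>P. ?R \<gamma> f\<^sub>0 y \<longrightarrow> y = x))" for P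
    unfolding One_nat_def
  proof (rule complete_parameter_setI)
    have range_eq: "{0..<M} = {0, 1, 2, 3}" unfolding M set_eq_iff range_4 by simp
    show "P \<subseteq> {0..<M} \<times> {0..<M}" using range by (simp only: range_eq)
    show "params \<gamma> f\<^sub>0" if "(\<gamma>, f\<^sub>0) \<in> P" for \<gamma> f\<^sub>0
      using params that by (auto simp: par c_def)
    fix \<gamma> f\<^sub>0
    assume prems: "params \<gamma> f\<^sub>0" "\<gamma> \<in> {0..<M}" "f\<^sub>0 \<in> {0..<M}"
    show "\<exists>!x. x \<in> P \<and> (\<exists>t. M dvd \<gamma> - fst x - N * t \<and> M dvd f\<^sub>0 - snd x - (c - 1) * t)"
      unfolding ex1_bounded M N t4 c_def
      by (rule unique [THEN bspec, OF prems(2) [unfolded range_eq], THEN bspec,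
            OF prems(3) [unfolded range_eq], THEN mp, OF prems(1) [unfolded par c_def]])
  qed
  show "complete_parameter_set 2 1 2 a b {(0, 0), (0, 2), (1, 0), (1, 2)}" if "(b, a) = (0, 1)"
    by (rule complete) (use that in simp_all)
  show "complete_parameter_set 2 1 2 a b {(0, 0), (2, 0), (1, 1), (3, 1)}" if "(b, a) = (0, 3)"
    by (rule complete) (use that in simp_all)
  show "complete_parameter_set 2 1 2 a b {(0, 0), (2, 0)}" if "(b, a) = (2, 1)"
    by (rule complete) (use that in simp_all)
  show "complete_parameter_set 2 1 2 a b {(0, 0), (2, 2), (1, 1), (3, 3)}" if "(b, a) = (2, 3)"
    by (rule complete) (use that in simp_all)
qed

section \<open>The classification\<close>

theorem theorem2p15:
  fixes p \<eta> r \<beta> u q q' :: nat and a b k' k'' :: int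
  assumes "prime p" and "\<eta> \<ge> 1" and "r \<ge> 1"
    and "odd p \<Longrightarrow> \<eta> < r" and "p = 2 \<Longrightarrow> (\<eta>, r) = (1, 2)"
    and "admissible_pair p \<eta> r a b"
    and "attached_data p \<eta> r a b \<beta> k' u q q' k''"
  shows
    "(p = 2 \<longrightarrow>
        (b, a) \<in> {(0, 1), (0, 3), (2, 1), (2, 3)} \<and>
        ((b, a) = (0, 1) \<longrightarrow>
           complete_parameter_set p \<eta> r a b {(0, 0), (0, 2), (1, 0), (1, 2)}) \<and>
        ((b, a) = (0, 3) \<longrightarrow>
           complete_parameter_set p \<eta> r a b {(0, 0), (2, 0), (1, 1), (3, 1)}) \<and>
        ((b, a) = (2, 1) \<longrightarrow>
           complete_parameter_set p \<eta> r a b {(0, 0), (2, 0)}) \<and>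
        ((b, a) = (2, 3) \<longrightarrow>
           complete_parameter_set p \<eta> r a b {(0, 0), (2, 2), (1, 1), (3, 3)})) \<and>
     (odd p \<and> \<eta> \<le> q \<longrightarrow>
        (q' \<le> \<beta> \<longrightarrow>
           complete_parameter_set p \<eta> r a b
             (param_set p r (int p ^ (r - q')) 0 (int p ^ (r - \<eta>))
               (p ^ (\<eta> + q' - r)) (p ^ \<eta>))) \<and>
        (q' > \<beta> \<longrightarrow>
           a \<noteq> 1 \<and> q = \<beta> \<and>
           complete_parameter_set p \<eta> r a b
             (param_set p r (int p ^ (r - q')) (int p ^ (r - q' + \<beta> - \<eta>) * (k'' - k'))
               (int p ^ (r - \<eta>)) (p ^ (\<eta> + q' - r)) (p ^ \<eta>)))) \<and>
     (odd p \<and> q < \<eta> \<longrightarrow>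
        ((q = q' \<and> q' = \<beta>) \<or> (q = q' \<and> q' < \<beta>) \<or> (q' = \<beta> \<and> \<beta> < q) \<or>
         (q = \<beta> \<and> \<beta> < q' \<and> q' \<le> r - \<eta> + \<beta>) \<or>
         (q = \<beta> \<and> \<beta> < q' \<and> q' > r - \<eta> + \<beta>)) \<and>
        (q = q' \<and> q' = \<beta> \<longrightarrow>
           complete_parameter_set p \<eta> r a b
             (param_set p r (int p ^ (r - q')) 0 (int p ^ (r - \<eta>))
               (p ^ q') (p ^ (\<beta> + \<eta> - r)))) \<and>
        (q = q' \<and> q' < \<beta> \<longrightarrow>
           a \<noteq> 1 \<and> r - q = \<eta> - u \<and>
           complete_parameter_set p \<eta> r a b
             (param_set p r (int p ^ (r - q')) 0 (int p ^ (r - \<eta>))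
               (p ^ q') (p ^ u))) \<and>
        (q' = \<beta> \<and> \<beta> < q \<longrightarrow>
           a \<noteq> 1 \<and> r - q' = \<eta> - u \<and>
           complete_parameter_set p \<eta> r a b
             (param_set p r (int p ^ (r - q')) 0 (int p ^ (r - \<eta>))
               (p ^ q') (p ^ (q + \<eta> - r)))) \<and>
        (q = \<beta> \<and> \<beta> < q' \<and> q' \<le> r - \<eta> + \<beta> \<longrightarrow>
           a \<noteq> 1 \<and> r - q = \<eta> - u \<and>
           complete_parameter_set p \<eta> r a b
             (param_set p r (int p ^ (r - q')) (int p ^ (r + \<beta> - q' - \<eta>) * k')
               (int p ^ (r - \<eta>)) (p ^ (\<eta> + q' - r)) (p ^ q))) \<and>
        (q = \<beta> \<and> \<beta> < q' \<and> q' > r - \<eta> + \<beta> \<longrightarrow>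
           a \<noteq> 1 \<and> r - q = \<eta> - u \<and>
           complete_parameter_set p \<eta> r a b
             (param_set p r (int p ^ (\<eta> - \<beta>)) k' (int p ^ (r - \<eta>))
               (p ^ \<beta>) (p ^ \<beta>))))"
proof -
  have p: "p > 1" using \<open>prime p\<close> by (rule prime_gt_1_nat)
  show ?thesis
  proof (cases "p = 2")
    case True
    then have eq: "p = 2" "\<eta> = 1" "r = 2" using assms(5) by simp_all
    then have "admissible_pair 2 1 2 a b" using assms(6) by simp
    note two = complete_parameter_set_2 [OF this]
    show ?thesis
      unfolding eq
    proof (intro conjI impI, goal_cases)
      case 1
      show ?case by (rule two(1))
    next
      case 2
      show ?case by (rule two(2) [OF 2(2)])
    next
      case 3
      show ?case by (rule two(3) [OF 3(2)])
    next
      case 4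
      show ?case by (rule two(4) [OF 4(2)])
    next
      case 5
      show ?case by (rule two(5) [OF 5(2)])
    qed simp_all
  next
    case False
    then have odd: "odd p" using \<open>prime p\<close> p prime_odd_nat by auto
    \<comment> \<open>The valuation of a - 1; for a = 1 the convention u = \<eta> yields v = r, the
      valuation of 0.\<close>
    define v where "v = r - \<eta> + u"
    have \<eta>: "\<eta> < r" using assms(4) odd .
    have b: "if b \<noteq> 0 then \<beta> < r \<and> k' \<in> carrier (I_lcs p r) \<and> \<not> int p dvd k' \<and>
           [b = int p ^ \<beta> * k'] (mod int (p ^ r)) else \<beta> = r \<and> k' = 1"
      and a: "if a \<noteq> 1 then u < \<eta> \<and> (\<exists>s\<in>carrier (I_lcs p r). \<not> int p dvd s \<and>
           [a - 1 = int p ^ (r - \<eta> + u) * s] (mod int (p ^ r))) else u = \<eta>"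
      and q: "q = Max {i. i \<le> r \<and> int p ^ i dvd b * a + a - 1}"
      and q': "q' = Max {i. i \<le> r \<and> int p ^ i dvd b * a - a + 1}"
      and k'': "coprime k'' (int p)" "[b * a + a - 1 = int p ^ q * k''] (mod int (p ^ r))"
      using assms(7) unfolding attached_data_def by blast+
    have b_eq: "int p ^ r dvd b - int p ^ \<beta> * k'"
      using b by (auto simp: cong_iff_dvd_diff split: if_splits)
    have val_b: "is_val p r b \<beta>"
    proof (cases "b = 0")
      case True
      then show ?thesis using b by (simp add: is_val_def)
    next
      case False
      then have "is_val p r (int p ^ \<beta> * k') \<beta>"
        using b \<open>prime p\<close> by (intro is_val_power_mult) auto
      then show ?thesis using is_val_cong [OF b_eq] by simp
    qed
    have a_neq: "a \<noteq> 1 \<longleftrightarrow> v < r" and u_le: "u \<le> \<eta>"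
      using a \<eta> by (auto simp: v_def split: if_splits)
    have val_a: "is_val p r (a - 1) v"
    proof (cases "a = 1")
      case True
      then show ?thesis using a \<eta> by (simp add: is_val_def v_def)
    next
      case False
      then obtain s where s: "\<not> int p dvd s" "int p ^ r dvd (a - 1) - int p ^ v * s"
        using a by (auto simp: v_def cong_iff_dvd_diff)
      have "is_val p r (int p ^ v * s) v"
        using False a_neq s(1) \<open>prime p\<close> by (intro is_val_power_mult) auto
      then show ?thesis using is_val_cong [OF s(2)] by simp
    qed
    interpret E: cyclic_extension p \<eta> r a b
      using p assms by unfold_locales auto
    have c: "E.c - 1 = b * a + a - 1" by (simp add: E.c_def algebra_simps)
    interpret E: valued_extension p \<eta> r a b q k'' \<beta> q' v k'
    proof unfold_locales
      show "int p ^ (r - \<eta>) dvd a - 1" using is_val_dvd [OF val_a, of "r - \<eta>"] by (simp add: v_def)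
      show "is_val p r (b * a + a - 1) q" "is_val p r (b * a - a + 1) q'"
        unfolding q q' by (rule is_val_Max)+
      then show "q \<le> r" by (simp add: is_val_le)
      show "E.M dvd E.c - 1 - int p ^ q * k''"
        using k''(2) by (simp add: c cong_iff_dvd_diff)
      show "E.M dvd b - int p ^ \<beta> * k'" using b_eq by simp
    qed (use \<open>prime p\<close> odd \<eta> k'' val_a val_b in auto)
    have diff: "r - x = \<eta> - u" if "v = x" for x
      using that u_le \<eta> by (simp add: v_def)
    \<comment> \<open>Lets the range p^(q + \<eta> - r) be written as p^u in the subcase q = q' <
      \<beta>.\<close>
    have u: "u = q + \<eta> - r" if "v = q"
      using that \<eta> by (simp add: v_def)
    have II2: "a \<noteq> 1 \<and> q = \<beta>" if "\<beta> < q'"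
      using that E.v_eq_beta E.q_eq_beta E.bounds(5) a_neq by simp
    \<comment> \<open>In the last four subcases of (III), v is the smaller of q and q', hence below
      \<eta>; so a - 1 is nonzero and r - v = \<eta> - u.\<close>
    have III: "a \<noteq> 1 \<and> r - x = \<eta> - u" if "v = x" "x < \<eta>" for x
      using that diff [OF that(1)] a_neq \<eta> by simp
    show ?thesis
    \<comment> \<open>The goals treated by name are the parameter sets for odd p and, as number 10,
      the exhaustiveness of the five subcases. The claims on a, q and u follow from
      \<open>II2\<close> and \<open>III\<close>, and those for p = 2 hold vacuously.\<close>
    proof (intro conjI impI, goal_cases)
      case 6
      then show ?case by (intro E.complete_II_le) simp_all
    next
      case 9
      then show ?case by (intro E.complete_II_gt) simp_all
    next
      case 10
      consider "q < q'" | "q' < q" | "q = q'" by linarith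
      then show ?case
      proof cases
        case 1
        with E.less_cases(1) show ?thesis by auto
      next
        case 2
        with E.less_cases(2) show ?thesis by auto
      next
        case 3
        with E.less_cases(3) show ?thesis by auto
      qed
    next
      case 11
      then have eq: "\<beta> = q" and "q' \<le> \<beta>" by simp_all
      then have "q' \<le> v" using E.q'_le_v by simp
      show ?case unfolding eq by (rule E.second_component) (use 11 \<open>q' \<le> v\<close> in simp_all)
    next
      case 14
      then have v: "v = q" using E.q_eq_v by simp
      show ?case unfolding u [OF v] by (rule E.second_component) (use 14 v in simp_all)
    next
      case 17
      then have "v = q'" using E.less_cases(2) by simp
      show ?case by (rule E.second_component) (use 17 \<open>v = q'\<close> in simp_all)
    next
      case 20
      then show ?case by (intro E.complete_III_le) simp_all
    next
      case 23
      then show ?case by (intro E.complete_III_gt) simp_all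
    qed (use False II2 III E.less_cases(1,2) E.q_eq_v in fastforce)+
  qed
qed

end
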